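(* Let $E\subset\mathbb{R}$ be a compact set of positive Lebesgue measure, and suppose there exists a discrete Schrödinger operator $H_V\in\mathcal{J}(E)$. Then either $V$ is a constant potential ($V(n)=C$ for all $n\in\mathbb{Z}$, for some $C\in\mathbb{R}$), or the dynamical system $(\mathcal{J}(E),\mathcal{S})$ is not minimal.
   Context: A Jacobi operator is a bounded self-adjoint operator $J=J(a,b)$ on $\ell^2(\mathbb{Z})$, $(Ju)_n = a_n u_{n-1} + b_n u_n + a_{n+1}u_{n+1}$, where $a,b\in\ell^\infty(\mathbb{Z})$ are real and the entries of $a$ are positive and bounded uniformly away from $0$. A discrete Schrödinger operator (DSO) is a Jacobi operator $H_V$ with $a_n=1$ for all $n$ and $b_n = V(n)$, where $V:\mathbb{Z}\to\mathbb{R}$ is bounded. Let $r(n,z,J)=\langle \delta_n,(J-z)^{-1}\delta_n\rangle$ and $r(n,x+i0,J)=\lim_{\varepsilon\downarrow 0} r(n,x+i\varepsilon,J)$, which exists for Lebesgue-a.e. $x\in\mathbb{R}$. $J$ is reflectionless on $E$ if for every $n\in\mathbb{Z}$, $\operatorname{Re}\, r(n,x+i0,J)=0$ for Lebesgue-a.e. $x\in E$. Define $\mathcal{J}(E)=\{J \text{ Jacobi operator}: \sigma(J)\subset E \text{ and } J \text{ is reflectionless on } E\}$, with the topology of pointwise convergence of the parametrizing sequences $(a,b)$. Let $S:\delta_n\mapsto\delta_{n+1}$ be the shift on $\ell^2(\mathbb{Z})$ and $\mathcal{S}J=SJS^{-1}$; $\mathcal{S}$ maps $\mathcal{J}(E)$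 to itself. The system $(\mathcal{J}(E),\mathcal{S})$ is minimal if every orbit is dense in $\mathcal{J}(E)$. *)

theory Defs
  imports "HOL-Analysis.Analysis"
begin

definition l2 :: "(int \<Rightarrow> complex) set" where
  "l2 = {u. (\<lambda>n. (cmod (u n))\<^sup>2) summable_on UNIV}"

definition l2_inner :: "(int \<Rightarrow> complex) \<Rightarrow> (int \<Rightarrow> complex) \<Rightarrow> complex" where
  "l2_inner u v = (\<Sum>\<^sub>\<infinity>n. cnj (u n) * v n)"

definition l2_norm :: "(int \<Rightarrow> complex) \<Rightarrow> real" where
  "l2_norm u = sqrt (\<Sum>\<^sub>\<infinity>n. (cmod (u n))\<^sup>2)"

definition delta :: "int \<Rightarrow> int \<Rightarrow> complex" where
  "delta n = (\<lambda>m. if m = n then 1 else 0)"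

(* Operators are functions on all of int => complex; only their restriction to l2 is used. *)
type_synonym seq_op = "(int \<Rightarrow> complex) \<Rightarrow> (int \<Rightarrow> complex)"

definition minus_scalar :: "seq_op \<Rightarrow> complex \<Rightarrow> seq_op" where
  "minus_scalar A z = (\<lambda>u n. A u n - z * u n)"

definition resolvent_set :: "seq_op \<Rightarrow> complex set" where
  "resolvent_set A = {z. bij_betw (minus_scalar A z) l2 l2 \<and>
     (\<exists>K. \<forall>v\<in>l2. l2_norm (inv_into l2 (minus_scalar A z) v) \<le> K * l2_norm v)}"

definition l2_spectrum :: "seq_op \<Rightarrow> complex set" where
  "l2_spectrum A = - resolvent_set A"

(* Meaningful for z in the resolvent set. *)
definition resolvent :: "seq_op \<Rightarrow> complex \<Rightarrow> seq_op" where
  "resolvent A z = inv_into l2 (minus_scalar A z)"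

definition green :: "int \<Rightarrow> complex \<Rightarrow> seq_op \<Rightarrow> complex" where
  "green n z A = l2_inner (delta n) (resolvent A z (delta n))"

(* The boundary value r(n, x + i0) exists for almost every x when A is self-adjoint,
   so requiring its existence almost everywhere on E is no restriction. *)
definition reflectionless_on :: "seq_op \<Rightarrow> real set \<Rightarrow> bool" where
  "reflectionless_on A E \<longleftrightarrow>
     (\<forall>n. AE x in lebesgue. x \<in> E \<longrightarrow>
        (\<exists>r. ((\<lambda>\<epsilon>. green n (Complex x \<epsilon>) A) \<longlongrightarrow> r) (at_right 0) \<and> Re r = 0))"

(* A Jacobi operator is represented by its pair (a, b) of parametrizing sequences. The
   topology that the type classes put on this type is the product topology, that is,
   pointwise convergence of a and of b. *)
type_synonym jacobi_params = "(int \<Rightarrow> real) \<times> (int \<Rightarrow> real)"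

definition is_jacobi :: "jacobi_params \<Rightarrow> bool" where
  "is_jacobi = (\<lambda>(a, b). bounded (range a) \<and> bounded (range b) \<and> (\<exists>c>0. \<forall>n. c \<le> a n))"

definition jacobi_op :: "jacobi_params \<Rightarrow> seq_op" where
  "jacobi_op = (\<lambda>(a, b) u n. of_real (a n) * u (n - 1) + of_real (b n) * u n
                              + of_real (a (n + 1)) * u (n + 1))"

definition schroedinger :: "(int \<Rightarrow> real) \<Rightarrow> jacobi_params" where
  "schroedinger V = ((\<lambda>n. 1), V)"

definition reflectionless_class :: "real set \<Rightarrow> jacobi_params set" where
  "reflectionless_class E = {p. is_jacobi p \<and> l2_spectrum (jacobi_op p) \<subseteq> of_real ` E \<and>
                                reflectionless_on (jacobi_op p) E}"

definition shift :: seq_op where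
  "shift u = (\<lambda>n. u (n - 1))"

lemma shift_delta: "shift (delta n) = delta (n + 1)"
  by (auto simp: shift_def delta_def fun_eq_iff)

lemma inv_shift: "inv shift = (\<lambda>u n. u (n + 1))"
  by (rule inv_unique_comp) (auto simp: shift_def fun_eq_iff)

(* Conjugation by the shift, in terms of the parametrizing sequences;
   see jacobi_op_shift_conj. *)
definition shift_conj :: "jacobi_params \<Rightarrow> jacobi_params" where
  "shift_conj = (\<lambda>(a, b). ((\<lambda>n. a (n - 1)), (\<lambda>n. b (n - 1))))"

lemma jacobi_op_shift_conj: "jacobi_op (shift_conj p) = shift \<circ> jacobi_op p \<circ> inv shift"
  by (cases p) (auto simp: inv_shift jacobi_op_def shift_conj_def shift_def fun_eq_iff add.commute)

lemma inv_shift_conj: "inv shift_conj = (\<lambda>(a, b). ((\<lambda>n. a (n + 1)), (\<lambda>n. b (n + 1))))"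
  by (rule inv_unique_comp) (auto simp: shift_conj_def fun_eq_iff)

lemma bij_shift_conj: "bij shift_conj"
  by (rule o_bij[of "\<lambda>(a, b). ((\<lambda>n. a (n + 1)), (\<lambda>n. b (n + 1)))"])
     (auto simp: shift_conj_def fun_eq_iff)

(* T is meant to be a bijection. *)
definition two_sided_orbit :: "('a \<Rightarrow> 'a) \<Rightarrow> 'a \<Rightarrow> 'a set" where
  "two_sided_orbit T x = (\<Union>k. {(T ^^ k) x, (inv T ^^ k) x})"

(* X is meant to be T-invariant, so that the orbits of its points lie in X. *)
definition minimal_system :: "'a::topological_space set \<Rightarrow> ('a \<Rightarrow> 'a) \<Rightarrow> bool" where
  "minimal_system X T \<longleftrightarrow> (\<forall>x\<in>X. X \<subseteq> closure (two_sided_orbit T x))"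

end

theory Submission
  imports Defs "HOL-Complex_Analysis.Complex_Analysis" "HOL-Real_Asymp.Real_Asymp"
begin

text \<open>
  Let \<open>\<mu>\<close> be far to the left of \<open>E\<close> and of the values of \<open>V\<close>, and factor \<open>H - \<mu> = A A\<^sup>*\<close> with a bidiagonal
  operator \<open>A\<close> with diagonal \<open>\<alpha>\<close> and off-diagonal \<open>\<beta>\<close>. Commuting the factors gives the Jacobi operator
  \<open>J' = A\<^sup>* A + \<mu>\<close>, and \<open>(J' - z)\<^sup>-\<^sup>1 = (A\<^sup>* (H - z)\<^sup>-\<^sup>1 A - 1) / (z - \<mu>)\<close>, so the spectrum does not grow.
  It is again reflectionless: its Green function contains the diagonal entries of the resolvent of \<open>H\<close>,
  whose boundary values are imaginary, and the neighbouring off-diagonal entries, whose boundary values have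
  real part \<open>1 / (2 a)\<close> almost everywhere on \<open>E\<close> by the Wronskian identity. Since \<open>H\<close> is a Schroedinger
  operator, \<open>\<alpha> (n - 1) \<beta> n = 1\<close>, so \<open>J'\<close> has the off-diagonal entries \<open>\<alpha> n / \<alpha> (n - 1)\<close>, which are all \<open>1\<close> only
  if \<open>\<alpha>\<close>, and hence \<open>V\<close>, is constant. But the orbit closure of \<open>H\<close> consists of operators with off-diagonal
  entries \<open>1\<close>, so it misses \<open>J'\<close> if \<open>V\<close> is not constant.
\<close>

subsection \<open>Square-summable sequences\<close>

lemma sum_le_l2_norm:
  assumes "u \<in> l2" "finite F"
  shows "(\<Sum>k\<in>F. (cmod (u k))\<^sup>2) \<le> (l2_norm u)\<^sup>2"
proof -
  have "(\<Sum>k\<in>F. (cmod (u k))\<^sup>2) \<le> (\<Sum>\<^sub>\<infinity>n. (cmod (u n))\<^sup>2)"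
    using assms by (intro finite_sum_le_infsum) (auto simp: l2_def)
  moreover have "0 \<le> (\<Sum>\<^sub>\<infinity>n. (cmod (u n))\<^sup>2)"
    by (rule infsum_nonneg) simp
  ultimately show ?thesis
    by (simp add: l2_norm_def)
qed

lemma l2_norm_nonneg [simp]: "0 \<le> l2_norm u"
  by (simp add: l2_norm_def infsum_nonneg)

text \<open>Reduces membership and norm estimates to finite partial sums, where termwise bounds and
  the triangle inequality for \<open>L2_set\<close> are available.\<close>

lemma l2_normI:
  assumes "0 \<le> C" and "\<And>F. finite F \<Longrightarrow> (\<Sum>k\<in>F. (cmod (u k))\<^sup>2) \<le> C\<^sup>2"
  shows l2I: "u \<in> l2" and l2_norm_leI: "l2_norm u \<le> C"
proof -
  have s: "(\<lambda>n. (cmod (u n))\<^sup>2) summable_on UNIV"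
    using assms(2) by (intro nonneg_bdd_above_summable_on) (auto simp: bdd_above_def)
  then show "u \<in> l2"
    by (simp add: l2_def)
  have "(\<Sum>\<^sub>\<infinity>n. (cmod (u n))\<^sup>2) \<le> C\<^sup>2"
    using s assms(2) by (intro infsum_le_finite_sums) auto
  then show "l2_norm u \<le> C"
    using assms(1) by (simp add: l2_norm_def real_le_lsqrt)
qed

lemma cmod_le_l2_norm: "u \<in> l2 \<Longrightarrow> cmod (u n) \<le> l2_norm u"
  using sum_le_l2_norm[of u "{n}"] by (auto intro: power2_le_imp_le)

lemma
  assumes "u \<in> l2" "v \<in> l2"
  shows l2_add: "(\<lambda>n. u n + v n) \<in> l2"
    and l2_norm_triangle: "l2_norm (\<lambda>n. u n + v n) \<le> l2_norm u + l2_norm v"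
proof -
  have "(\<Sum>k\<in>F. (cmod (u k + v k))\<^sup>2) \<le> (l2_norm u + l2_norm v)\<^sup>2" if "finite F" for F
  proof -
    have b: "L2_set (\<lambda>k. cmod (w k)) F \<le> l2_norm w" if "w \<in> l2" for w
      using sum_le_l2_norm[OF that \<open>finite F\<close>] by (simp add: L2_set_def real_le_lsqrt)
    have "L2_set (\<lambda>k. cmod (u k + v k)) F \<le> L2_set (\<lambda>k. cmod (u k) + cmod (v k)) F"
      by (intro L2_set_mono) (auto intro: norm_triangle_ineq)
    also have "\<dots> \<le> L2_set (\<lambda>k. cmod (u k)) F + L2_set (\<lambda>k. cmod (v k)) F"
      by (rule L2_set_triangle_ineq)
    also have "\<dots> \<le> l2_norm u + l2_norm v"
      using b assms by (intro add_mono) auto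
    finally have "(L2_set (\<lambda>k. cmod (u k + v k)) F)\<^sup>2 \<le> (l2_norm u + l2_norm v)\<^sup>2"
      by (intro power_mono) auto
    then show ?thesis
      by (simp add: L2_set_def sum_nonneg)
  qed
  then show "(\<lambda>n. u n + v n) \<in> l2" "l2_norm (\<lambda>n. u n + v n) \<le> l2_norm u + l2_norm v"
    using l2_normI[of "l2_norm u + l2_norm v" "\<lambda>n. u n + v n"] by simp_all
qed

lemma
  assumes "u \<in> l2" "\<And>n. cmod (c n) \<le> C"
  shows l2_mult: "(\<lambda>n. c n * u n) \<in> l2"
    and l2_norm_mult_le: "l2_norm (\<lambda>n. c n * u n) \<le> C * l2_norm u"
proof -
  have C: "0 \<le> C"
    using assms(2)[of 0] by (rule order_trans[OF norm_ge_zero])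
  have "(\<Sum>k\<in>F. (cmod (c k * u k))\<^sup>2) \<le> (C * l2_norm u)\<^sup>2" if "finite F" for F
  proof -
    have "(\<Sum>k\<in>F. (cmod (c k * u k))\<^sup>2) \<le> (\<Sum>k\<in>F. C\<^sup>2 * (cmod (u k))\<^sup>2)"
      using assms(2) by (intro sum_mono) (simp add: norm_mult power_mult_distrib mult_right_mono power_mono)
    also have "\<dots> \<le> C\<^sup>2 * (l2_norm u)\<^sup>2"
      unfolding sum_distrib_left[symmetric]
      using sum_le_l2_norm[OF assms(1) that] by (intro mult_left_mono) auto
    finally show ?thesis
      by (simp add: power_mult_distrib)
  qed
  then show "(\<lambda>n. c n * u n) \<in> l2" "l2_norm (\<lambda>n. c n * u n) \<le> C * l2_norm u"
    using l2_normI[of "C * l2_norm u" "\<lambda>n. c n * u n"] C by simp_all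
qed

lemma l2_scale: "u \<in> l2 \<Longrightarrow> (\<lambda>n. c * u n) \<in> l2"
  by (rule l2_mult) auto

lemma l2_norm_scale: "u \<in> l2 \<Longrightarrow> l2_norm (\<lambda>n. c * u n) \<le> cmod c * l2_norm u"
  by (rule l2_norm_mult_le) auto

lemma l2_diff: "u \<in> l2 \<Longrightarrow> v \<in> l2 \<Longrightarrow> (\<lambda>n. u n - v n) \<in> l2"
  using l2_add[of u "\<lambda>n. - 1 * v n"] l2_scale[of v "- 1"] by simp

lemma l2_norm_triangle_diff:
  assumes "u \<in> l2" "v \<in> l2"
  shows "l2_norm (\<lambda>n. u n - v n) \<le> l2_norm u + l2_norm v"
proof -
  have "l2_norm (\<lambda>n. u n - v n) \<le> l2_norm u + l2_norm (\<lambda>n. - 1 * v n)"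
    using l2_norm_triangle[OF assms(1) l2_scale[OF assms(2), of "- 1"]] by simp
  also have "l2_norm (\<lambda>n. - 1 * v n) \<le> l2_norm v"
    using l2_norm_scale[OF assms(2), of "- 1"] by simp
  finally show ?thesis
    by simp
qed

lemma bij_betw_translation_int: "bij_betw (\<lambda>n. n + k) (UNIV :: int set) UNIV"
  by (rule bij_betw_byWitness[of _ "\<lambda>n. n - k"]) auto

lemma l2_translate: "(\<lambda>n. u (n + k)) \<in> l2 \<longleftrightarrow> u \<in> l2"
  using summable_on_reindex_bij_betw[OF bij_betw_translation_int, of "\<lambda>n. (cmod (u n))\<^sup>2" k]
  by (simp add: l2_def)

lemma l2_norm_translate: "l2_norm (\<lambda>n. u (n + k)) = l2_norm u"
  using infsum_reindex_bij_betw[OF bij_betw_translation_int, of "\<lambda>n. (cmod (u n))\<^sup>2" k]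
  by (simp add: l2_norm_def)

lemma l2_translate': "(\<lambda>n. u (n - k)) \<in> l2 \<longleftrightarrow> u \<in> l2"
  using l2_translate[of u "- k"] by simp

lemma l2_norm_translate': "l2_norm (\<lambda>n. u (n - k)) = l2_norm u"
  using l2_norm_translate[of u "- k"] by simp

lemma delta_in_l2 [simp]: "delta m \<in> l2"
proof (rule l2I[of 1])
  fix F :: "int set"
  assume "finite F"
  have "(\<Sum>k\<in>F. (cmod (delta m k))\<^sup>2) = (\<Sum>k\<in>F. if k = m then 1 else 0)"
    by (intro sum.cong) (auto simp: delta_def)
  with \<open>finite F\<close> show "(\<Sum>k\<in>F. (cmod (delta m k))\<^sup>2) \<le> 1\<^sup>2"
    by (simp add: sum.delta)
qed simp

lemma delta_same [simp]: "delta n n = 1"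
  by (simp add: delta_def)

lemma l2_inner_delta: "l2_inner (delta n) u = u n"
proof -
  have "l2_inner (delta n) u = (\<Sum>\<^sub>\<infinity>k\<in>{n}. cnj (delta n k) * u k)"
    unfolding l2_inner_def by (rule infsum_cong_neutral) (auto simp: delta_def)
  then show ?thesis
    by (simp add: delta_def)
qed

lemma l2_tendsto_zero_inj:
  assumes "u \<in> l2" "inj (g :: nat \<Rightarrow> int)"
  shows "(\<lambda>j. u (g j)) \<longlonglongrightarrow> 0"
proof -
  have "(\<lambda>n. (cmod (u n))\<^sup>2) summable_on range g"
    using assms(1) by (auto simp: l2_def intro: summable_on_subset_banach)
  then have "(\<lambda>j. (cmod (u (g j)))\<^sup>2) summable_on UNIV"
    by (simp add: summable_on_reindex[OF assms(2)] o_def)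
  then have "summable (\<lambda>j. (cmod (u (g j)))\<^sup>2)"
    by (rule summable_on_imp_summable)
  then have "(\<lambda>j. (cmod (u (g j)))\<^sup>2) \<longlonglongrightarrow> 0"
    by (rule summable_LIMSEQ_zero)
  then show ?thesis
    by (simp add: tendsto_norm_zero_iff)
qed

lemma l2_tendsto_zero:
  assumes "u \<in> l2"
  shows "(\<lambda>j. u (m + int j)) \<longlonglongrightarrow> 0" "(\<lambda>j. u (m - int j)) \<longlonglongrightarrow> 0"
  by (auto intro!: l2_tendsto_zero_inj[OF assms] simp: inj_def)

section \<open>Sequences on the integers that are monotone or constant towards one end\<close>

text \<open>This lemma and the next three evaluate boundary terms: a flux or Wronskian that is
  monotone or constant along a half-line and vanishes at its end has a known sign or value at its
  start.\<close>

lemma ge_zero_if_antimono_tendsto_zero: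
  fixes F :: "int \<Rightarrow> real"
  assumes "\<And>k. k > m \<Longrightarrow> F k \<le> F (k - 1)" "(\<lambda>j. F (m + int j)) \<longlonglongrightarrow> 0"
  shows "0 \<le> F m"
proof -
  have "F (m + int (Suc j)) \<le> F (m + int j)" for j
    using assms(1)[of "m + int (Suc j)"] by (simp add: algebra_simps)
  then have "decseq (\<lambda>j. F (m + int j))"
    by (rule decseq_SucI)
  from decseq_ge[OF this assms(2), of 0] show ?thesis
    by simp
qed

lemma ge_zero_if_mono_tendsto_zero:
  fixes F :: "int \<Rightarrow> real"
  assumes "\<And>k. k \<le> m \<Longrightarrow> F (k - 1) \<le> F k" "(\<lambda>j. F (m - int j)) \<longlonglongrightarrow> 0"
  shows "0 \<le> F m"
proof -
  have "F (- k) \<le> F (- (k - 1))" if "k > - m" for k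
    using assms(1)[of "1 - k"] that by simp
  moreover have "(\<lambda>j. F (- (- m + int j))) \<longlonglongrightarrow> 0"
    using assms(2) by simp
  ultimately show ?thesis
    using ge_zero_if_antimono_tendsto_zero[of "- m" "\<lambda>k. F (- k)"] by simp
qed

lemma eq_zero_if_const_tendsto_zero:
  fixes W :: "int \<Rightarrow> complex"
  assumes "\<And>k. k > m \<Longrightarrow> W k = W (k - 1)" "(\<lambda>j. W (m + int j)) \<longlonglongrightarrow> 0"
  shows "W m = 0"
proof -
  have "W (m + int j) = W m" for j
  proof (induction j)
    case (Suc j)
    then show ?case
      using assms(1)[of "m + int (Suc j)"] by (simp add: algebra_simps)
  qed simp
  then show ?thesis
    using assms(2) by (simp add: LIMSEQ_const_iff)
qed

lemma eq_zero_if_const_tendsto_zero':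
  fixes W :: "int \<Rightarrow> complex"
  assumes "\<And>k. k \<le> m \<Longrightarrow> W k = W (k - 1)" "(\<lambda>j. W (m - int j)) \<longlonglongrightarrow> 0"
  shows "W m = 0"
proof -
  have "W (- k) = W (- (k - 1))" if "k > - m" for k
    using assms(1)[of "1 - k"] that by simp
  moreover have "(\<lambda>j. W (- (- m + int j))) \<longlonglongrightarrow> 0"
    using assms(2) by simp
  ultimately show ?thesis
    using eq_zero_if_const_tendsto_zero[of "- m" "\<lambda>k. W (- k)"] by simp
qed

subsection \<open>Resolvents\<close>

lemma
  assumes "z \<in> resolvent_set T" "f \<in> l2"
  shows resolvent_in_l2: "resolvent T z f \<in> l2"
    and minus_scalar_resolvent: "minus_scalar T z (resolvent T z f) = f"
proof -
  have "bij_betw (minus_scalar T z) l2 l2"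
    using assms(1) by (simp add: resolvent_set_def)
  then show "resolvent T z f \<in> l2" "minus_scalar T z (resolvent T z f) = f"
    using assms(2) unfolding resolvent_def
    by (auto simp: bij_betw_def inv_into_into f_inv_into_f)
qed

lemma resolvent_eqI:
  assumes "z \<in> resolvent_set T" "u \<in> l2" "minus_scalar T z u = f"
  shows "resolvent T z f = u"
proof -
  have "inj_on (minus_scalar T z) l2"
    using assms(1) by (auto simp: resolvent_set_def bij_betw_def)
  then show ?thesis
    using inv_into_f_f[of "minus_scalar T z" l2 u] assms(2,3) by (simp add: resolvent_def)
qed

text \<open>\<open>R\<close> is a candidate for the inverse. \<open>inv\<close> makes it a right
  inverse, which yields surjectivity; injectivity comes from \<open>kernel\<close> by
  linearity.\<close>

lemma resolvent_setI:
  assumes lin: "\<And>u v c. T (\<lambda>n. u n + c * v n) = (\<lambda>n. T u n + c * T v n)"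
    and maps: "\<And>u. u \<in> l2 \<Longrightarrow> minus_scalar T z u \<in> l2"
    and kernel: "\<And>u n. u \<in> l2 \<Longrightarrow> (\<And>n. minus_scalar T z u n = 0) \<Longrightarrow> u n = 0"
    and inv: "\<And>f. f \<in> l2 \<Longrightarrow> R f \<in> l2" "\<And>f. f \<in> l2 \<Longrightarrow> minus_scalar T z (R f) = f"
    and bound: "\<And>f. f \<in> l2 \<Longrightarrow> l2_norm (R f) \<le> K * l2_norm f"
  shows "z \<in> resolvent_set T"
proof -
  have inj: "inj_on (minus_scalar T z) l2"
  proof (rule inj_onI, rule ext)
    fix u v n
    assume u: "u \<in> l2" and v: "v \<in> l2" and eq: "minus_scalar T z u = minus_scalar T z v"
    have "minus_scalar T z (\<lambda>n. u n + - 1 * v n) k = minus_scalar T z u k - minus_scalar T z v k" for k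
      unfolding minus_scalar_def lin by (simp add: algebra_simps)
    then show "u n = v n"
      using kernel[OF l2_add[OF u l2_scale[OF v, of "- 1"]], of n] eq by simp
  qed
  have "bij_betw (minus_scalar T z) l2 l2"
    unfolding bij_betw_def
  proof (intro conjI inj subset_antisym subsetI)
    fix f
    assume "f \<in> l2"
    then show "f \<in> minus_scalar T z ` l2"
      using inv by (intro image_eqI[of _ _ "R f"]) auto
  qed (use maps in auto)
  moreover have "inv_into l2 (minus_scalar T z) f = R f" if "f \<in> l2" for f
    using inv_into_f_f[OF inj inv(1)[OF that]] inv(2)[OF that] by simp
  ultimately show ?thesis
    using bound by (auto simp: resolvent_set_def)
qed

lemma resolvent_bound:
  assumes "z \<in> resolvent_set T"
  obtains K where "K \<ge> 0" "\<And>f. f \<in> l2 \<Longrightarrow> l2_norm (resolvent T z f) \<le> K * l2_norm f"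
proof -
  obtain K where K: "\<And>f. f \<in> l2 \<Longrightarrow> l2_norm (resolvent T z f) \<le> K * l2_norm f"
    using assms by (auto simp: resolvent_set_def resolvent_def)
  \<comment> \<open>The bound in the definition of the resolvent set may be negative, hence the
    absolute value.\<close>
  have "l2_norm (resolvent T z f) \<le> \<bar>K\<bar> * l2_norm f" if "f \<in> l2" for f
    using K[OF that] mult_right_mono[OF abs_ge_self[of K] l2_norm_nonneg[of f]] by linarith
  then show thesis
    by (rule that[of "\<bar>K\<bar>", rotated]) auto
qed

text \<open>Both sides lie in \<open>l2\<close> and have the same image under \<open>T - w\<close>,
  which is injective there.\<close>

lemma resolvent_identity:
  assumes z: "z \<in> resolvent_set T" and w: "w \<in> resolvent_set T" and f: "f \<in> l2"
    and lin: "\<And>u v c. T (\<lambda>n. u n + c * v n) = (\<lambda>n. T u n + c * T v n)"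
  shows "resolvent T z f = (\<lambda>n. resolvent T w f n + (z - w) * resolvent T w (resolvent T z f) n)"
proof -
  let ?u = "resolvent T z f" and ?R = "resolvent T w"
  have u: "?u \<in> l2"
    by (rule resolvent_in_l2[OF z f])
  note Ru = resolvent_in_l2[OF w u] and Rf = resolvent_in_l2[OF w f]
  have "minus_scalar T w ?u n
      = minus_scalar T w (\<lambda>n. ?R f n + (z - w) * ?R ?u n) n" for n
  proof -
    have "T ?u n = f n + z * ?u n" "T (?R f) n = f n + w * ?R f n" "T (?R ?u) n = ?u n + w * ?R ?u n"
      using fun_cong[OF minus_scalar_resolvent[OF z f], of n] fun_cong[OF minus_scalar_resolvent[OF w f], of n]
        fun_cong[OF minus_scalar_resolvent[OF w u], of n]
      by (simp_all add: minus_scalar_def diff_eq_eq)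
    then show ?thesis
      unfolding minus_scalar_def lin by (simp add: algebra_simps)
  qed
  then have "minus_scalar T w ?u = minus_scalar T w (\<lambda>n. ?R f n + (z - w) * ?R ?u n)"
    by blast
  then show ?thesis
    using resolvent_eqI[OF w u refl] resolvent_eqI[OF w l2_add[OF Rf l2_scale[OF Ru]] refl] by simp
qed

lemma resolvent_linear:
  assumes z: "z \<in> resolvent_set T" and u: "u \<in> l2" and v: "v \<in> l2"
    and lin: "\<And>u v c. T (\<lambda>n. u n + c * v n) = (\<lambda>n. T u n + c * T v n)"
  shows "resolvent T z (\<lambda>n. u n + c * v n) = (\<lambda>n. resolvent T z u n + c * resolvent T z v n)"
proof (rule resolvent_eqI[OF z])
  note Ru = resolvent_in_l2[OF z u] and Rv = resolvent_in_l2[OF z v]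
  show "(\<lambda>n. resolvent T z u n + c * resolvent T z v n) \<in> l2"
    by (rule l2_add[OF Ru l2_scale[OF Rv]])
  have "T (resolvent T z u) n = u n + z * resolvent T z u n" "T (resolvent T z v) n = v n + z * resolvent T z v n" for n
    using fun_cong[OF minus_scalar_resolvent[OF z u], of n] fun_cong[OF minus_scalar_resolvent[OF z v], of n]
    by (simp_all add: minus_scalar_def diff_eq_eq)
  then show "minus_scalar T z (\<lambda>n. resolvent T z u n + c * resolvent T z v n) = (\<lambda>n. u n + c * v n)"
    unfolding minus_scalar_def lin by (simp add: algebra_simps)
qed

text \<open>With \<open>R\<close> the resolvent at \<open>w\<close> and \<open>u\<close> the
  resolvent at \<open>z\<close> applied to \<open>f\<close>, two uses of the resolvent identity show
  that the difference quotient minus \<open>R (R f)\<close> is \<open>(z - w) * R (R u)\<close>. It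
  remains to bound \<open>u\<close> uniformly for \<open>z\<close> near \<open>w\<close>.\<close>

lemma resolvent_holomorphic:
  assumes S: "open S" "S \<subseteq> resolvent_set T" and f: "f \<in> l2"
    and lin: "\<And>u v c. T (\<lambda>n. u n + c * v n) = (\<lambda>n. T u n + c * T v n)"
  shows "(\<lambda>z. resolvent T z f n) holomorphic_on S"
proof -
  have "((\<lambda>z. resolvent T z f n) has_field_derivative resolvent T w (resolvent T w f) n) (at w)"
    if w: "w \<in> S" for w
  proof -
    let ?R = "resolvent T w" and ?u = "\<lambda>z. resolvent T z f"
    have wr: "w \<in> resolvent_set T"
      using S w by blast
    obtain K where K: "K \<ge> 0" "\<And>g. g \<in> l2 \<Longrightarrow> l2_norm (?R g) \<le> K * l2_norm g"
      using resolvent_bound[OF wr] by metis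
    have in2: "?R g \<in> l2" if "g \<in> l2" for g
      by (rule resolvent_in_l2[OF wr that])
    let ?C = "K * (K * (2 * l2_norm (?R f)))"
    have est: "norm ((?u z n - ?u w n) / (z - w) - ?R (?R f) n) \<le> ?C * norm (z - w)"
      if z: "z \<in> S" "z \<noteq> w" "norm (z - w) * K \<le> 1 / 2" for z
    proof -
      have zr: "z \<in> resolvent_set T"
        using S z by blast
      have u: "?u z \<in> l2"
        by (rule resolvent_in_l2[OF zr f])
      note id = resolvent_identity[OF zr wr f lin]
      have "(?u z n - ?u w n) / (z - w) = ?R (?u z) n"
        using fun_cong[OF id, of n] z(2) by simp
      also have "?R (?u z) = ?R (\<lambda>n. ?R f n + (z - w) * ?R (?u z) n)"
        by (rule arg_cong[OF id])
      also have "\<dots> = (\<lambda>n. ?R (?R f) n + (z - w) * ?R (?R (?u z)) n)"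
        by (rule resolvent_linear[OF wr in2[OF f] in2[OF u] lin])
      finally have "(?u z n - ?u w n) / (z - w) - ?R (?R f) n = (z - w) * ?R (?R (?u z)) n"
        by simp
      then have diff: "norm ((?u z n - ?u w n) / (z - w) - ?R (?R f) n) = cmod (?R (?R (?u z)) n) * norm (z - w)"
        by (simp add: norm_mult)
      have "cmod (?R (?R (?u z)) n) \<le> l2_norm (?R (?R (?u z)))"
        by (rule cmod_le_l2_norm[OF in2[OF in2[OF u]]])
      also have "\<dots> \<le> K * l2_norm (?R (?u z))"
        by (rule K(2)[OF in2[OF u]])
      also have "\<dots> \<le> K * (K * l2_norm (?u z))"
        by (rule mult_left_mono[OF K(2)[OF u] K(1)])
      also have "\<dots> \<le> ?C"
      proof -
        \<comment> \<open>The identity bounds the norm of \<open>?u z\<close> by that of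
          \<open>?R f\<close> plus \<open>norm (z - w) * K\<close> times itself. This factor is at
          most one half, so the last term is absorbed; hence the 2 in \<open>?C\<close>.\<close>
        have "l2_norm (?u z) = l2_norm (\<lambda>n. ?R f n + (z - w) * ?R (?u z) n)"
          by (rule arg_cong[OF id])
        also have "\<dots> \<le> l2_norm (?R f) + l2_norm (\<lambda>n. (z - w) * ?R (?u z) n)"
          by (rule l2_norm_triangle[OF in2[OF f] l2_scale[OF in2[OF u]]])
        also have "l2_norm (\<lambda>n. (z - w) * ?R (?u z) n) \<le> norm (z - w) * (K * l2_norm (?u z))"
          using l2_norm_scale[OF in2[OF u], of "z - w"] mult_left_mono[OF K(2)[OF u], of "norm (z - w)"] by simp
        also have "\<dots> = (norm (z - w) * K) * l2_norm (?u z)"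
          by simp
        also have "\<dots> \<le> 1 / 2 * l2_norm (?u z)"
          by (rule mult_right_mono[OF z(3)]) simp
        finally have "l2_norm (?u z) \<le> 2 * l2_norm (?R f)"
          by simp
        then show ?thesis
          by (intro mult_left_mono K(1))
      qed
      finally show ?thesis
        unfolding diff by (rule mult_right_mono) simp
    qed
    have ev: "\<forall>\<^sub>F z in at w. z \<in> S \<and> z \<noteq> w \<and> norm (z - w) * K \<le> 1 / 2"
    proof (intro eventually_conj)
      show "\<forall>\<^sub>F z in at w. z \<in> S"
        using S(1) w by (rule eventually_at_in_open')
      show "\<forall>\<^sub>F z in at w. z \<noteq> w"
        by (simp add: eventually_at_filter)
      have "((\<lambda>z. norm (z - w) * K) \<longlongrightarrow> norm (w - w) * K) (at w)"
        by (intro tendsto_intros)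
      then have "\<forall>\<^sub>F z in at w. norm (z - w) * K < 1 / 2"
        by (rule order_tendstoD) simp
      then show "\<forall>\<^sub>F z in at w. norm (z - w) * K \<le> 1 / 2"
        by (rule eventually_mono) simp
    qed
    have "((\<lambda>z. ?C * norm (z - w)) \<longlongrightarrow> ?C * norm (w - w)) (at w)"
      by (intro tendsto_intros)
    then have lim0: "((\<lambda>z. ?C * norm (z - w)) \<longlongrightarrow> 0) (at w)"
      by simp
    have "((\<lambda>z. (?u z n - ?u w n) / (z - w) - ?R (?R f) n) \<longlongrightarrow> 0) (at w)"
    proof (rule Lim_null_comparison[OF _ lim0])
      show "\<forall>\<^sub>F z in at w. norm ((?u z n - ?u w n) / (z - w) - ?R (?R f) n) \<le> ?C * norm (z - w)"
        using ev by (rule eventually_mono) (use est in blast)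
    qed
    then show ?thesis
      unfolding has_field_derivative_iff by (rule LIM_zero_cancel)
  qed
  then show ?thesis
    using S(1) by (auto simp: holomorphic_on_open)
qed

subsection \<open>Green functions of Jacobi operators\<close>

lemma jacobi_op_linear:
  "jacobi_op p (\<lambda>n. u n + c * v n) = (\<lambda>n. jacobi_op p u n + c * jacobi_op p v n)"
  by (cases p) (simp add: jacobi_op_def algebra_simps)

locale jacobi =
  fixes a b :: "int \<Rightarrow> real"
  assumes is_jacobi: "is_jacobi (a, b)"
begin

abbreviation J :: seq_op where "J \<equiv> jacobi_op (a, b)"

abbreviation G :: "int \<Rightarrow> int \<Rightarrow> complex \<Rightarrow> complex" where
  "G n m z \<equiv> resolvent J z (delta m) n"

lemma a_pos: "0 < a n"
  using is_jacobi unfolding is_jacobi_def by (auto intro: less_le_trans)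

lemma coefficients_bounded:
  obtains M where "M > 0" "\<And>n. a n \<le> M" "\<And>n. \<bar>b n\<bar> \<le> M"
proof -
  obtain A B where "\<And>n. \<bar>a n\<bar> \<le> A" "\<And>n. \<bar>b n\<bar> \<le> B"
    using is_jacobi by (auto simp: is_jacobi_def bounded_iff)
  then show thesis
    using that[of "max 1 (max A B)"] by (meson abs_ge_self less_max_iff_disj max.coboundedI1 max.coboundedI2 order_trans zero_less_one)
qed

lemma minus_scalar_in_l2:
  assumes "u \<in> l2"
  shows "minus_scalar J z u \<in> l2"
proof -
  obtain M where M: "\<And>n. a n \<le> M" "\<And>n. \<bar>b n\<bar> \<le> M"
    using coefficients_bounded by metis
  have "cmod (of_real (a n)) \<le> M" "cmod (of_real (b n)) \<le> M" for n
    using M[of n] a_pos[of n] by simp_all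
  then have "(\<lambda>n. of_real (a n) * u (n - 1)) \<in> l2" "(\<lambda>n. of_real (b n) * u n) \<in> l2"
    "(\<lambda>n. of_real (a (n + 1)) * u (n + 1)) \<in> l2"
    using assms by (auto intro!: l2_mult[of _ _ M] simp: l2_translate l2_translate')
  then show ?thesis
    unfolding minus_scalar_def jacobi_op_def by (simp add: l2_add l2_diff l2_scale assms)
qed

lemma green_eq: "green n z J = G n n z"
  by (simp add: green_def l2_inner_delta)

section \<open>Wronskian and flux identities for the columns of the resolvent\<close>

lemma resolvent_row:
  assumes "z \<in> resolvent_set J" "f \<in> l2"
  shows "of_real (a n) * resolvent J z f (n - 1) + (of_real (b n) - z) * resolvent J z f n
    + of_real (a (n + 1)) * resolvent J z f (n + 1) = f n"
  using fun_cong[OF minus_scalar_resolvent[OF assms], of n]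
  by (simp add: minus_scalar_def jacobi_op_def algebra_simps)

lemma tendsto_zero_mult_a:
  assumes "F \<longlonglongrightarrow> (0 :: complex)"
  shows "(\<lambda>j. of_real (a (g j)) * F j) \<longlonglongrightarrow> 0"
proof -
  obtain M where M: "\<And>n. a n \<le> M"
    using coefficients_bounded by metis
  have "Bfun (\<lambda>j. complex_of_real (a (g j))) sequentially"
    by (rule BfunI[of _ M]) (use M a_pos in \<open>auto simp: less_imp_le\<close>)
  moreover have "Zfun F sequentially"
    using assms by (simp add: tendsto_Zfun_iff)
  ultimately have "Zfun (\<lambda>j. of_real (a (g j)) * F j) sequentially"
    by (rule bounded_bilinear.Bfun_prod_Zfun[OF bounded_bilinear_mult])
  then show ?thesis
    by (simp add: tendsto_Zfun_iff)
qed

text \<open>\<open>W\<close> is the discrete Wronskian of columns \<open>n\<close> and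
  \<open>n + 1\<close>. It jumps only at these two sites and vanishes at both ends, so
  \<open>W (n - 1)\<close> and \<open>W (n + 1)\<close> are zero. The two jumps give two expressions
  for \<open>W n\<close>: equating them is the symmetry, and inserting it into the definition of
  \<open>W n\<close> is the quadratic identity.\<close>

lemma wronskian:
  assumes z: "z \<in> resolvent_set J"
  shows green_offdiag_sym: "G (n + 1) n z = G n (n + 1) z"
    and green_wronskian: "of_real (a (n + 1)) * ((G n (n + 1) z)\<^sup>2 - G n n z * G (n + 1) (n + 1) z) = G n (n + 1) z"
proof -
  let ?u = "resolvent J z (delta n)" and ?v = "resolvent J z (delta (n + 1))"
  define W where "W k = of_real (a (k + 1)) * (?u k * ?v (k + 1) - ?u (k + 1) * ?v k)" for k
  note mem = resolvent_in_l2[OF z delta_in_l2]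
  have step: "W k - W (k - 1) = ?u k * delta (n + 1) k - ?v k * delta n k" for k
    unfolding W_def resolvent_row[OF z delta_in_l2, of k, symmetric]
    by (simp add: algebra_simps)
  have lims: "(\<lambda>j. W (m + int j)) \<longlonglongrightarrow> 0" "(\<lambda>j. W (m - int j)) \<longlonglongrightarrow> 0" for m
  proof -
    have "(\<lambda>j. ?u (m + int j) * ?v (m + 1 + int j) - ?u (m + 1 + int j) * ?v (m + int j)) \<longlonglongrightarrow> 0 * 0 - 0 * 0"
      by (intro tendsto_intros l2_tendsto_zero mem)
    then show "(\<lambda>j. W (m + int j)) \<longlonglongrightarrow> 0"
      unfolding W_def by (intro tendsto_zero_mult_a) (simp add: algebra_simps)
    have "(\<lambda>j. ?u (m - int j) * ?v (m + 1 - int j) - ?u (m + 1 - int j) * ?v (m - int j)) \<longlonglongrightarrow> 0 * 0 - 0 * 0"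
      by (intro tendsto_intros l2_tendsto_zero mem)
    then show "(\<lambda>j. W (m - int j)) \<longlonglongrightarrow> 0"
      unfolding W_def by (intro tendsto_zero_mult_a) (simp add: algebra_simps)
  qed
  have const: "W k = W (k - 1)" if "k \<noteq> n" "k \<noteq> n + 1" for k
    using step[of k] that by (simp add: delta_def)
  have "W (n - 1) = 0"
    by (rule eq_zero_if_const_tendsto_zero'[OF _ lims(2)], rule const) auto
  moreover have "W (n + 1) = 0"
    by (rule eq_zero_if_const_tendsto_zero[OF _ lims(1)], rule const) auto
  ultimately have Wn: "W n = - ?v n" and "W n = - ?u (n + 1)"
    using step[of n] step[of "n + 1"] by (auto simp: delta_def algebra_simps)
  then show sym: "?u (n + 1) = ?v n"
    by simp
  show "of_real (a (n + 1)) * ((?v n)\<^sup>2 - ?u n * ?v (n + 1)) = ?v n"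
    using Wn unfolding W_def sym by (simp add: algebra_simps power2_eq_square)
qed

text \<open>Keeps three terms of the identity between the imaginary part of \<open>G n n z\<close>
  and \<open>Im z\<close> times the squared norm of column \<open>n\<close>. \<open>F\<close> is the
  flux of the column: it is nondecreasing off site \<open>n\<close> and vanishes at both ends, so it
  is nonnegative to the left of \<open>n\<close> and nonpositive to the right.\<close>

lemma Im_green_ge:
  assumes z: "z \<in> resolvent_set J" "0 < Im z"
  shows "Im z * ((cmod (G (n - 1) n z))\<^sup>2 + (cmod (G n n z))\<^sup>2 + (cmod (G (n + 1) n z))\<^sup>2) \<le> Im (G n n z)"
proof -
  let ?u = "resolvent J z (delta n)"
  define F where "F k = a (k + 1) * Im (cnj (?u k) * ?u (k + 1))" for k
  have mem: "?u \<in> l2"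
    by (rule resolvent_in_l2[OF z(1) delta_in_l2])
  have step: "F k - F (k - 1) = Im z * (cmod (?u k))\<^sup>2 + Im (cnj (?u k) * delta n k)" for k
    unfolding F_def resolvent_row[OF z(1) delta_in_l2, of k n, symmetric] cmod_power2
    by (simp add: algebra_simps power2_eq_square)
  have lims: "(\<lambda>j. F (m + int j)) \<longlonglongrightarrow> 0" "(\<lambda>j. F (m - int j)) \<longlonglongrightarrow> 0" for m
  proof -
    have F: "F k = Im (of_real (a (k + 1)) * (cnj (?u k) * ?u (k + 1)))" for k
      unfolding F_def by simp
    have "(\<lambda>j. cnj (?u (m + int j)) * ?u (m + 1 + int j)) \<longlonglongrightarrow> cnj 0 * 0"
      by (intro tendsto_intros l2_tendsto_zero mem)
    then have "(\<lambda>j. of_real (a (m + int j + 1)) * (cnj (?u (m + int j)) * ?u (m + int j + 1))) \<longlonglongrightarrow> 0"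
      by (intro tendsto_zero_mult_a) (simp add: algebra_simps)
    from tendsto_Im[OF this] show "(\<lambda>j. F (m + int j)) \<longlonglongrightarrow> 0"
      unfolding F by simp
    have "(\<lambda>j. cnj (?u (m - int j)) * ?u (m + 1 - int j)) \<longlonglongrightarrow> cnj 0 * 0"
      by (intro tendsto_intros l2_tendsto_zero mem)
    then have "(\<lambda>j. of_real (a (m - int j + 1)) * (cnj (?u (m - int j)) * ?u (m - int j + 1))) \<longlonglongrightarrow> 0"
      by (intro tendsto_zero_mult_a) (simp add: algebra_simps)
    from tendsto_Im[OF this] show "(\<lambda>j. F (m - int j)) \<longlonglongrightarrow> 0"
      unfolding F by simp
  qed
  have mono: "F (k - 1) \<le> F k" if "k \<noteq> n" for k
  proof -
    have "0 \<le> Im z * (cmod (?u k))\<^sup>2"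
      using z(2) by simp
    then show ?thesis
      using step[of k] that by (simp add: delta_def)
  qed
  \<comment> \<open>\<open>F k\<close> belongs to the bond from \<open>k\<close> to
    \<open>k + 1\<close>, so the sites \<open>n - 1\<close>, \<open>n\<close>, \<open>n + 1\<close>
    are crossed between \<open>F (n - 2)\<close> and \<open>F (n + 1)\<close>.\<close>
  have "0 \<le> - F (n + 1)"
    by (rule ge_zero_if_antimono_tendsto_zero) (use mono tendsto_minus[OF lims(1)] in auto)
  moreover have "0 \<le> F (n - 2)"
    by (rule ge_zero_if_mono_tendsto_zero[OF _ lims(2)]) (use mono in auto)
  ultimately show ?thesis
    using step[of n] step[of "n + 1"] step[of "n - 1"] by (simp add: delta_def algebra_simps)
qed

end

subsection \<open>Boundary values of Herglotz functions\<close>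

text \<open>The root maps the right half-plane into the sector of arguments at most pi/4 in modulus,
  where the real part is at least the modulus over \<open>sqrt 2\<close>.\<close>

lemma Re_csqrt_ge: "sqrt (cmod z) \<le> sqrt 2 * Re (csqrt z)" if "0 \<le> Re z"
proof -
  have "cmod z / 2 \<le> (cmod z + Re z) / 2"
    using that by simp
  then have "sqrt (cmod z / 2) \<le> Re (csqrt z)"
    by simp
  then have "sqrt 2 * sqrt (cmod z / 2) \<le> sqrt 2 * Re (csqrt z)"
    by (rule mult_left_mono) simp
  then show ?thesis
    by (simp add: real_sqrt_mult[symmetric])
qed

text \<open>A vertical limit of zero makes \<open>Q = 1 / csqrt (- \<i> F)\<close> blow up. But \<open>Q\<close> has positive real part,
  and it grows at most like \<open>y powr (- 1 / 2)\<close>, so a primitive of \<open>Q\<close> stays bounded on vertical lines. Hence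
  the integrals of \<open>Re Q\<close> over horizontal segments are bounded, and Fatou's lemma applies.\<close>

lemma AE_not_tendsto_zero:
  fixes F :: "complex \<Rightarrow> complex"
  assumes holo: "F holomorphic_on {z. 0 < Im z}"
    and pos: "\<And>z. 0 < Im z \<Longrightarrow> 0 < Im (F z)"
    and lower: "\<And>R. \<exists>c>0. \<forall>z. cmod z \<le> R \<longrightarrow> 0 < Im z \<longrightarrow> c * Im z \<le> Im (F z)"
  shows "AE x in lebesgue. \<not> ((\<lambda>\<epsilon>. F (Complex x \<epsilon>)) \<longlongrightarrow> 0) (at_right 0)"
proof -
  define Q where "Q z = 1 / csqrt (- \<i> * F z)" for z
  let ?H = "{z. 0 < Im z}"
  have H: "open ?H" "convex ?H"
    by (auto simp: open_halfspace_Im_gt convex_halfspace_Im_gt)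
  have F_nz: "F z \<noteq> 0" if "0 < Im z" for z
    using pos[OF that] by auto
  \<comment> \<open>Multiplication by \<open>- \<i>\<close> turns the upper half-plane into the
    right one, away from the branch cut of \<open>csqrt\<close>.\<close>
  have "- \<i> * F z \<notin> \<real>\<^sub>\<le>\<^sub>0" if "0 < Im z" for z
    using pos[OF that] by (simp add: complex_nonpos_Reals_iff del: mult_minus_left)
  then have "(\<lambda>z. csqrt (- \<i> * F z)) holomorphic_on ?H"
    by (intro holomorphic_intros holo) auto
  then have Q_holo: "Q holomorphic_on ?H"
    unfolding Q_def by (intro holomorphic_on_divide holomorphic_on_const) (auto simp: F_nz)
  have Q_norm: "cmod (Q z) = 1 / sqrt (cmod (F z))" for z
    by (simp add: Q_def norm_divide norm_mult)
  \<comment> \<open>The reciprocal stays in the sector of \<open>Re_csqrt_ge\<close>, so blow-up of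
    the modulus of \<open>Q\<close> forces blow-up of its real part.\<close>
  have Re_Q: "cmod (Q z) \<le> sqrt 2 * Re (Q z)" if z: "0 < Im z" for z
  proof -
    let ?s = "csqrt (- \<i> * F z)"
    have "cmod ?s \<le> sqrt 2 * Re ?s"
      using Re_csqrt_ge[of "- \<i> * F z"] pos[OF z] by (simp del: csqrt.sel)
    then have "cmod ?s / (cmod ?s)\<^sup>2 \<le> sqrt 2 * Re ?s / (cmod ?s)\<^sup>2"
      by (rule divide_right_mono) simp
    moreover have "Re (Q z) = Re ?s / (cmod ?s)\<^sup>2"
      unfolding Q_def cmod_power2 by (simp add: Re_divide del: csqrt.sel)
    moreover have "cmod (Q z) = cmod ?s / (cmod ?s)\<^sup>2"
      by (simp add: Q_def norm_divide power2_eq_square del: csqrt.sel norm_csqrt)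
    ultimately show ?thesis
      by simp
  qed
  have Re_Q_nonneg: "0 \<le> Re (Q z)" if "0 < Im z" for z
    using order_trans[OF norm_ge_zero Re_Q[OF that]] by (simp add: zero_le_mult_iff)
  obtain P where P0: "\<And>z. z \<in> ?H \<Longrightarrow> (P has_field_derivative Q z) (at z within ?H)"
    using holomorphic_convex_primitive'[OF H(2,1) Q_holo] by metis
  have P: "(P has_field_derivative Q z) (at z)" if "0 < Im z" for z
    using P0[of z] at_within_open[OF _ H(1), of z] that by simp
  have main: "AE x in lborel. x \<in> {- R..R} \<longrightarrow> \<not> ((\<lambda>\<epsilon>. F (Complex x \<epsilon>)) \<longlongrightarrow> 0) (at_right 0)"
    if R: "0 < R" for R
  proof -
    \<comment> \<open>The disc of radius \<open>R + 1\<close> contains the rectangle of height 1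
      over \<open>{- R..R}\<close>, so one constant serves there.\<close>
    obtain c where c: "c > 0" "\<And>z. cmod z \<le> R + 1 \<Longrightarrow> 0 < Im z \<Longrightarrow> c * Im z \<le> Im (F z)"
      using lower[of "R + 1"] by blast
    have Q_bound: "cmod (Q (Complex x y)) \<le> 1 / sqrt c * (1 / sqrt y)" if "\<bar>x\<bar> \<le> R" "0 < y" "y \<le> 1" for x y
    proof -
      have "cmod (Complex x y) \<le> R + 1"
        using cmod_le[of "Complex x y"] that by simp
      then have "c * y \<le> cmod (F (Complex x y))"
        using c(2)[of "Complex x y"] that abs_Im_le_cmod[of "F (Complex x y)"] by simp
      then have "1 / sqrt (cmod (F (Complex x y))) \<le> 1 / sqrt (c * y)"
        using c(1) that(2) by (intro divide_left_mono) (auto simp: F_nz)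
      then show ?thesis
        by (simp add: Q_norm real_sqrt_mult)
    qed
    have vertical: "cmod (P (Complex x 1) - P (Complex x \<epsilon>)) \<le> 2 / sqrt c"
      if x: "\<bar>x\<bar> \<le> R" and \<epsilon>: "0 < \<epsilon>" "\<epsilon> < 1" for x \<epsilon>
    proof -
      have Cxy: "((\<lambda>y. Complex x y) has_vector_derivative \<i>) (at y)" for y
        unfolding Complex_eq by (auto intro!: derivative_eq_intros)
      have dP: "((\<lambda>y. P (Complex x y)) has_vector_derivative (\<i> * Q (Complex x y))) (at y)" if "0 < y" for y
        using field_vector_diff_chain_at[OF Cxy P[of "Complex x y"]] that by (simp add: o_def)
      have dphi: "((\<lambda>y. 2 / sqrt c * sqrt y) has_vector_derivative (1 / sqrt c * (1 / sqrt y))) (at y)" if "0 < y" for y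
        unfolding has_real_derivative_iff_has_vector_derivative[symmetric]
        using that c(1) by (auto intro!: derivative_eq_intros simp: field_simps)
      have "norm (P (Complex x 1) - P (Complex x \<epsilon>)) \<le> 2 / sqrt c * sqrt 1 - 2 / sqrt c * sqrt \<epsilon>"
      proof (rule differentiable_bound_general[OF \<epsilon>(2)])
        show "continuous_on {\<epsilon>..1} (\<lambda>y. P (Complex x y))"
          using \<epsilon> by (intro continuous_at_imp_continuous_on ballI has_vector_derivative_continuous[OF dP]) auto
        show "continuous_on {\<epsilon>..1} (\<lambda>y. 2 / sqrt c * sqrt y)"
          by (intro continuous_intros)
        show "norm (\<i> * Q (Complex x y)) \<le> 1 / sqrt c * (1 / sqrt y)" if "\<epsilon> < y" "y < 1" for y
          using Q_bound[OF x, of y] that \<epsilon> by (simp add: norm_mult)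
      qed (use dP dphi \<epsilon> in auto)
      also have "\<dots> \<le> 2 / sqrt c"
        using c(1) \<epsilon> by simp
      finally show ?thesis .
    qed
    \<comment> \<open>\<open>4 / sqrt c\<close> is the bound of \<open>vertical\<close> for the two
      sides that lead from height \<open>\<epsilon> k\<close> to height 1; it does not depend on
      \<open>k\<close>.\<close>
    define C where "C = cmod (P (Complex R 1)) + cmod (P (Complex (- R) 1)) + 4 / sqrt c"
    define \<epsilon> where "\<epsilon> k = 1 / (real k + 2)" for k
    have \<epsilon>: "0 < \<epsilon> k" "\<epsilon> k < 1" for k
      by (auto simp: \<epsilon>_def)
    define f where "f k x = ennreal (Re (Q (Complex x (\<epsilon> k)))) * indicator {- R..R} x" for k x
    have cont: "continuous_on UNIV (\<lambda>x. Re (Q (Complex x (\<epsilon> k))))" for k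
    proof (rule continuous_on_Re, rule continuous_on_compose2[OF holomorphic_on_imp_continuous_on[OF Q_holo]])
      show "continuous_on UNIV (\<lambda>x. Complex x (\<epsilon> k))"
        unfolding Complex_eq by (intro continuous_intros)
    qed (use \<epsilon> in auto)
    have meas0: "(\<lambda>x. Re (Q (Complex x (\<epsilon> k)))) \<in> borel_measurable borel" for k
      by (rule borel_measurable_continuous_onI[OF cont])
    then have meas: "f k \<in> borel_measurable lborel" for k
      unfolding f_def by measurable
    have int: "(\<integral>\<^sup>+x. f k x \<partial>lborel) \<le> ennreal C" for k
    proof -
      let ?p = "\<lambda>x. P (Complex x (\<epsilon> k))"
      have "(\<integral>\<^sup>+x. f k x \<partial>lborel) = ennreal (Re (?p R) - Re (?p (- R)))"
        unfolding f_def
      proof (rule nn_integral_FTC_Icc[OF meas0])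
        fix x
        have Cxy: "((\<lambda>x. Complex x (\<epsilon> k)) has_vector_derivative 1) (at x)"
          unfolding Complex_eq by (auto intro!: derivative_eq_intros)
        have "(?p has_vector_derivative Q (Complex x (\<epsilon> k))) (at x)"
          using field_vector_diff_chain_at[OF Cxy P[of "Complex x (\<epsilon> k)"]] \<epsilon> by (simp add: o_def)
        from bounded_linear.has_vector_derivative[OF bounded_linear_Re this]
        show "((\<lambda>x. Re (?p x)) has_real_derivative Re (Q (Complex x (\<epsilon> k)))) (at x)"
          unfolding has_real_derivative_iff_has_vector_derivative .
        show "0 \<le> Re (Q (Complex x (\<epsilon> k)))"
          using Re_Q_nonneg \<epsilon> by simp
      qed (use R in auto)
      also have "Re (?p R) - Re (?p (- R)) \<le> C"
      proof -
        have "\<bar>Re (?p x)\<bar> \<le> cmod (P (Complex x 1)) + 2 / sqrt c" if "\<bar>x\<bar> \<le> R" for x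
          using vertical[OF that \<epsilon>(1,2), of k] abs_Re_le_cmod[of "?p x"]
            norm_triangle_sub[of "?p x" "P (Complex x 1)"] by (simp add: norm_minus_commute)
        from this[of R] this[of "- R"] show ?thesis
          using R unfolding C_def by simp
      qed
      finally show ?thesis
        by (simp add: ennreal_leI)
    qed
    \<comment> \<open>Fatou: the lower limit has finite integral, hence is finite almost everywhere,
      whereas a zero limit of \<open>F\<close> at a point of the interval makes it infinite.\<close>
    have "(\<integral>\<^sup>+x. liminf (\<lambda>k. f k x) \<partial>lborel) \<le> liminf (\<lambda>k. \<integral>\<^sup>+x. f k x \<partial>lborel)"
      by (rule nn_integral_liminf[OF meas])
    also have "\<dots> \<le> liminf (\<lambda>k::nat. ennreal C)"
      by (intro Liminf_mono always_eventually allI int)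
    also have "\<dots> = ennreal C"
      by (simp add: Liminf_const)
    finally have "(\<integral>\<^sup>+x. liminf (\<lambda>k. f k x) \<partial>lborel) \<noteq> \<infinity>"
      by (auto simp: top_unique)
    then have "AE x in lborel. liminf (\<lambda>k. f k x) \<noteq> \<infinity>"
      using meas by (intro nn_integral_noteq_infinite) auto
    then show ?thesis
    proof (rule AE_mp, intro AE_I2 impI notI)
      fix x
      assume fin: "liminf (\<lambda>k. f k x) \<noteq> \<infinity>" and x: "x \<in> {- R..R}"
        and lim: "((\<lambda>\<epsilon>. F (Complex x \<epsilon>)) \<longlongrightarrow> 0) (at_right 0)"
      have "filterlim \<epsilon> (at_right 0) sequentially"
        unfolding \<epsilon>_def by real_asymp
      with lim have "(\<lambda>k. F (Complex x (\<epsilon> k))) \<longlonglongrightarrow> 0"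
        by (rule filterlim_compose)
      then have "(\<lambda>k. sqrt (cmod (F (Complex x (\<epsilon> k))))) \<longlonglongrightarrow> sqrt (cmod 0)"
        by (intro tendsto_intros)
      then have "filterlim (\<lambda>k. sqrt (cmod (F (Complex x (\<epsilon> k))))) (at_right 0) sequentially"
        using F_nz \<epsilon> by (intro tendsto_imp_filterlim_at_right) (auto intro!: always_eventually)
      then have "filterlim (\<lambda>k. inverse (sqrt (cmod (F (Complex x (\<epsilon> k)))))) at_top sequentially"
        by (rule filterlim_compose[OF filterlim_inverse_at_top_right])
      then have top: "filterlim (\<lambda>k. cmod (Q (Complex x (\<epsilon> k)))) at_top sequentially"
        by (simp add: Q_norm inverse_eq_divide)
      have "filterlim (\<lambda>k. sqrt 2 * Re (Q (Complex x (\<epsilon> k)))) at_top sequentially"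
        by (rule filterlim_at_top_mono[OF top]) (use Re_Q \<epsilon> in \<open>auto intro!: always_eventually\<close>)
      then have "filterlim (\<lambda>k. Re (Q (Complex x (\<epsilon> k)))) at_top sequentially"
        by (subst (asm) filterlim_tendsto_pos_mult_at_top_iff[OF tendsto_const]) auto
      then have "(\<lambda>k. ennreal (Re (Q (Complex x (\<epsilon> k))))) \<longlonglongrightarrow> \<infinity>"
        by (simp add: ennreal_tendsto_top_eq_at_top)
      then have "(\<lambda>k. f k x) \<longlonglongrightarrow> \<infinity>"
        using x by (simp add: f_def)
      then have "liminf (\<lambda>k. f k x) = \<infinity>"
        by (rule lim_imp_Liminf[rotated]) simp
      with fin show False
        by simp
    qed
  qed
  \<comment> \<open>The radii are \<open>real N + 1\<close> because \<open>main\<close> asks for a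
    positive radius.\<close>
  have "AE x in lborel. \<forall>N::nat. x \<in> {- (real N + 1)..real N + 1} \<longrightarrow>
      \<not> ((\<lambda>\<epsilon>. F (Complex x \<epsilon>)) \<longlongrightarrow> 0) (at_right 0)"
    unfolding AE_all_countable by (intro allI main) simp
  then have "AE x in lborel. \<not> ((\<lambda>\<epsilon>. F (Complex x \<epsilon>)) \<longlongrightarrow> 0) (at_right 0)"
  proof (rule AE_mp, intro AE_I2 impI)
    fix x :: real
    assume all: "\<forall>N::nat. x \<in> {- (real N + 1)..real N + 1} \<longrightarrow> \<not> ((\<lambda>\<epsilon>. F (Complex x \<epsilon>)) \<longlongrightarrow> 0) (at_right 0)"
    obtain N :: nat where "\<bar>x\<bar> \<le> real N"
      using real_arch_simple by blast
    then show "\<not> ((\<lambda>\<epsilon>. F (Complex x \<epsilon>)) \<longlongrightarrow> 0) (at_right 0)"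
      using all[rule_format, of N] by (auto simp: abs_le_iff)
  qed
  then show ?thesis
    by (rule AE_completion)
qed

text \<open>If \<open>D \<noteq> 0\<close>, then \<open>Re (h \<epsilon> / csqrt D)\<close> does not vanish for small \<open>\<epsilon>\<close>, so it keeps its sign and
  selects one of the two square roots.\<close>

lemma tendsto_of_tendsto_power2:
  fixes h :: "real \<Rightarrow> complex"
  assumes cont: "continuous_on {0<..} h" and lim: "((\<lambda>\<epsilon>. (h \<epsilon>)\<^sup>2) \<longlongrightarrow> D) (at_right 0)"
  obtains l where "(h \<longlongrightarrow> l) (at_right 0)" "l\<^sup>2 = D"
proof (cases "D = 0")
  case True
  have "((\<lambda>\<epsilon>. sqrt (cmod ((h \<epsilon>)\<^sup>2))) \<longlongrightarrow> sqrt (cmod D)) (at_right 0)"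
    by (intro tendsto_intros lim)
  then have "(h \<longlongrightarrow> 0) (at_right 0)"
    using True by (simp add: norm_power tendsto_norm_zero_iff)
  then show thesis
    using that True by simp
next
  case False
  define s where "s = csqrt D"
  have s: "s\<^sup>2 = D" "s \<noteq> 0"
    using False by (simp_all add: s_def)
  define k where "k \<epsilon> = h \<epsilon> / s" for \<epsilon>
  have "((\<lambda>\<epsilon>. (h \<epsilon>)\<^sup>2 / D) \<longlongrightarrow> D / D) (at_right 0)"
    by (intro tendsto_intros lim False)
  then have k_lim: "((\<lambda>\<epsilon>. (k \<epsilon>)\<^sup>2) \<longlongrightarrow> 1) (at_right 0)"
    using False by (simp add: k_def power_divide s(1))
  then have "\<forall>\<^sub>F \<epsilon> in at_right 0. dist ((k \<epsilon>)\<^sup>2) 1 < 1"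
    by (rule tendstoD) simp
  then obtain d where d: "d > 0" "\<And>\<epsilon>. 0 < \<epsilon> \<Longrightarrow> \<epsilon> < d \<Longrightarrow> dist ((k \<epsilon>)\<^sup>2) 1 < 1"
    unfolding eventually_at_right_field by auto
  have Re_nz: "Re (k \<epsilon>) \<noteq> 0" if \<epsilon>: "0 < \<epsilon>" "\<epsilon> < d" for \<epsilon>
  proof
    assume "Re (k \<epsilon>) = 0"
    then have "Re ((k \<epsilon>)\<^sup>2 - 1) = - (Im (k \<epsilon>))\<^sup>2 - 1"
      by (simp add: power2_eq_square)
    then have "1 \<le> \<bar>Re ((k \<epsilon>)\<^sup>2 - 1)\<bar>"
      using zero_le_power2[of "Im (k \<epsilon>)"] by linarith
    also have "\<dots> \<le> dist ((k \<epsilon>)\<^sup>2) 1"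
      unfolding dist_norm by (rule abs_Re_le_cmod)
    finally show False
      using d(2)[OF \<epsilon>] by simp
  qed
  have "continuous_on {0<..<d} (\<lambda>\<epsilon>. Re (k \<epsilon>))"
    unfolding k_def by (intro continuous_intros continuous_on_subset[OF cont]) (use s in auto)
  then have conn: "connected ((\<lambda>\<epsilon>. Re (k \<epsilon>)) ` {0<..<d})"
    by (rule connected_continuous_image) simp
  have sign: "(\<forall>\<epsilon>\<in>{0<..<d}. 0 < Re (k \<epsilon>)) \<or> (\<forall>\<epsilon>\<in>{0<..<d}. 0 < Re (- k \<epsilon>))"
  proof (rule ccontr)
    assume "\<not> ?thesis"
    then obtain p q where pq: "p \<in> {0<..<d}" "q \<in> {0<..<d}" "Re (k p) \<le> 0" "0 \<le> Re (k q)"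
      by (auto simp: not_less)
    have "0 \<in> (\<lambda>\<epsilon>. Re (k \<epsilon>)) ` {0<..<d}"
      by (rule connectedD_interval[OF conn imageI[OF pq(1)] imageI[OF pq(2)] pq(3,4)])
    then obtain e where "0 < e" "e < d" "0 = Re (k e)"
      by (elim imageE) auto
    then show False
      using Re_nz[of e] by simp
  qed
  \<comment> \<open>Applied to \<open>k\<close> or \<open>- k\<close>, whichever has positive real
    part; there \<open>csqrt\<close> undoes squaring, and it is continuous at 1.\<close>
  have one: "(f \<longlongrightarrow> 1) (at_right 0)"
    if pos: "\<forall>\<epsilon>\<in>{0<..<d}. 0 < Re (f \<epsilon>)" and f: "((\<lambda>\<epsilon>. (f \<epsilon>)\<^sup>2) \<longlongrightarrow> 1) (at_right 0)" for f
  proof -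
    have "isCont csqrt 1"
      by (rule continuous_at_csqrt) simp
    then have "((\<lambda>\<epsilon>. csqrt ((f \<epsilon>)\<^sup>2)) \<longlongrightarrow> csqrt 1) (at_right 0)"
      using f by (rule isCont_tendsto_compose)
    moreover have "\<forall>\<^sub>F \<epsilon> in at_right 0. csqrt ((f \<epsilon>)\<^sup>2) = f \<epsilon>"
      unfolding eventually_at_right_field using d(1) pos by (intro exI[of _ d]) (auto intro!: csqrt_square)
    ultimately show ?thesis
      by (simp add: tendsto_cong)
  qed
  have h: "h = (\<lambda>\<epsilon>. s * k \<epsilon>)"
    using s by (simp add: k_def fun_eq_iff)
  from sign show thesis
  proof
    assume "\<forall>\<epsilon>\<in>{0<..<d}. 0 < Re (k \<epsilon>)"
    from tendsto_mult_left[OF one[OF this k_lim], of s] show thesis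
      using that[of s] s h by simp
  next
    assume "\<forall>\<epsilon>\<in>{0<..<d}. 0 < Re (- k \<epsilon>)"
    then have "((\<lambda>\<epsilon>. - k \<epsilon>) \<longlongrightarrow> 1) (at_right 0)"
      by (rule one) (simp add: k_lim)
    then have "((\<lambda>\<epsilon>. - s * - k \<epsilon>) \<longlongrightarrow> - s * 1) (at_right 0)"
      by (rule tendsto_mult_left)
    then show thesis
      using that[of "- s"] s by (simp add: h)
  qed
qed

subsection \<open>Boundary values of Green functions\<close>

context jacobi
begin

text \<open>Row \<open>n\<close> of the resolvent equation has right-hand side 1 and coefficients
  bounded on discs, so the three entries of column \<open>n\<close> around the diagonal cannot all
  be small; \<open>Im_green_ge\<close> carries this over to the imaginary part.\<close>

lemma Im_green_lower_bound:
  assumes upper: "{z. 0 < Im z} \<subseteq> resolvent_set J"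
  shows "\<exists>c>0. \<forall>z. cmod z \<le> R \<longrightarrow> 0 < Im z \<longrightarrow> c * Im z \<le> Im (G n n z)"
proof -
  obtain M where M: "M > 0" "\<And>n. a n \<le> M" "\<And>n. \<bar>b n\<bar> \<le> M"
    using coefficients_bounded by metis
  define B where "B = M + \<bar>R\<bar>"
  have B: "B > 0"
    using M by (simp add: B_def)
  have "1 / (3 * B\<^sup>2) * Im z \<le> Im (G n n z)" if z: "cmod z \<le> R" "0 < Im z" for z
  proof -
    let ?p = "cmod (G (n - 1) n z)" and ?q = "cmod (G n n z)" and ?r = "cmod (G (n + 1) n z)"
    have zr: "z \<in> resolvent_set J"
      using upper z by auto
    have aB: "cmod (of_real (a k)) \<le> B" for k
      using a_pos[of k] M(2)[of k] by (simp add: B_def)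
    have bB: "cmod (of_real (b n) - z) \<le> B"
      using norm_triangle_ineq4[of "of_real (b n)" z] M(3)[of n] z(1) by (simp add: B_def)
    have "1 = cmod (of_real (a n) * G (n - 1) n z + (of_real (b n) - z) * G n n z + of_real (a (n + 1)) * G (n + 1) n z)"
      unfolding resolvent_row[OF zr delta_in_l2] by (simp add: delta_def)
    also have "\<dots> \<le> cmod (of_real (a n)) * ?p + cmod (of_real (b n) - z) * ?q + cmod (of_real (a (n + 1))) * ?r"
      unfolding norm_mult[symmetric] by (intro norm_triangle_le add_right_mono norm_triangle_ineq)
    also have "\<dots> \<le> B * ?p + B * ?q + B * ?r"
      by (intro add_mono mult_right_mono aB bB norm_ge_zero)
    finally have "1 \<le> (B * (?p + ?q + ?r))\<^sup>2"
      by (simp add: algebra_simps one_le_power)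
    also have "\<dots> = B\<^sup>2 * (?p + ?q + ?r)\<^sup>2"
      by (rule power_mult_distrib)
    also have "\<dots> \<le> B\<^sup>2 * (3 * (?p\<^sup>2 + ?q\<^sup>2 + ?r\<^sup>2))"
    proof (rule mult_left_mono)
      have "0 \<le> (?p - ?q)\<^sup>2 + (?q - ?r)\<^sup>2 + (?p - ?r)\<^sup>2"
        by simp
      then show "(?p + ?q + ?r)\<^sup>2 \<le> 3 * (?p\<^sup>2 + ?q\<^sup>2 + ?r\<^sup>2)"
        by (simp add: power2_eq_square algebra_simps)
    qed simp
    finally have "1 / (3 * B\<^sup>2) \<le> ?p\<^sup>2 + ?q\<^sup>2 + ?r\<^sup>2"
      using B by (simp add: field_simps)
    then have "Im z * (1 / (3 * B\<^sup>2)) \<le> Im z * (?p\<^sup>2 + ?q\<^sup>2 + ?r\<^sup>2)"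
      using z(2) by (intro mult_left_mono) auto
    also have "\<dots> \<le> Im (G n n z)"
      by (rule Im_green_ge[OF zr z(2)])
    finally show ?thesis
      by (simp add: mult.commute)
  qed
  then show ?thesis
    using B by (intro exI[of _ "1 / (3 * B\<^sup>2)"]) simp
qed

lemma green_holomorphic:
  assumes "{z. 0 < Im z} \<subseteq> resolvent_set J"
  shows "(\<lambda>z. G n m z) holomorphic_on {z. 0 < Im z}"
  using open_halfspace_Im_gt[of 0] by (intro resolvent_holomorphic assms delta_in_l2 jacobi_op_linear) auto

lemma AE_green_not_tendsto_zero:
  assumes upper: "{z. 0 < Im z} \<subseteq> resolvent_set J"
  shows "AE x in lebesgue. \<not> ((\<lambda>\<epsilon>. G n n (Complex x \<epsilon>)) \<longlongrightarrow> 0) (at_right 0)"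
proof (rule AE_not_tendsto_zero)
  note lower = Im_green_lower_bound[OF upper, of _ n]
  show "(\<lambda>z. G n n z) holomorphic_on {z. 0 < Im z}"
    by (rule green_holomorphic[OF upper])
  show "0 < Im (G n n z)" if z: "0 < Im z" for z
  proof -
    obtain c where "c > 0" "c * Im z \<le> Im (G n n z)"
      using lower[of "cmod z"] z by auto
    then show ?thesis
      using mult_pos_pos[of c "Im z"] z by linarith
  qed
  show "\<exists>c>0. \<forall>z. cmod z \<le> R \<longrightarrow> 0 < Im z \<longrightarrow> c * Im z \<le> Im (G n n z)" for R
    by (rule lower)
qed

text \<open>Completing the square in \<open>green_wronskian\<close> expresses the square of
  \<open>h\<close> by the two diagonal entries. Its limit \<open>D\<close> is real, since the
  product of two imaginary limits is real, so the limit of \<open>h\<close> is imaginary or real;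
  these are the two alternatives.\<close>

lemma green_offdiag_limit:
  assumes upper: "{z. 0 < Im z} \<subseteq> resolvent_set J"
    and r: "((\<lambda>\<epsilon>. G n n (Complex x \<epsilon>)) \<longlongrightarrow> r) (at_right 0)" "Re r = 0"
    and r': "((\<lambda>\<epsilon>. G (n + 1) (n + 1) (Complex x \<epsilon>)) \<longlongrightarrow> r') (at_right 0)" "Re r' = 0"
  obtains g where "((\<lambda>\<epsilon>. G n (n + 1) (Complex x \<epsilon>)) \<longlongrightarrow> g) (at_right 0)"
    "a (n + 1) * Re g = 1 / 2 \<or> Im g = 0"
proof -
  let ?\<alpha> = "a (n + 1)"
  define h where "h \<epsilon> = G n (n + 1) (Complex x \<epsilon>) - of_real (1 / (2 * ?\<alpha>))" for \<epsilon>
  define D where "D = (of_real (1 / (2 * ?\<alpha>)))\<^sup>2 + r * r'"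
  have \<alpha>: "?\<alpha> \<noteq> 0"
    using a_pos[of "n + 1"] by simp
  have "continuous_on {0<..} (\<lambda>\<epsilon>. G n (n + 1) (Complex x \<epsilon>))"
  proof (rule continuous_on_compose2[OF holomorphic_on_imp_continuous_on[OF green_holomorphic[OF upper]]])
    show "continuous_on {0<..} (\<lambda>\<epsilon>. Complex x \<epsilon>)"
      unfolding Complex_eq by (intro continuous_intros)
  qed auto
  then have "continuous_on {0<..} h"
    unfolding h_def by (rule continuous_on_diff[OF _ continuous_on_const])
  moreover have "((\<lambda>\<epsilon>. (h \<epsilon>)\<^sup>2) \<longlongrightarrow> D) (at_right 0)"
  proof -
    have sq: "(h \<epsilon>)\<^sup>2 = (of_real (1 / (2 * ?\<alpha>)))\<^sup>2 + G n n (Complex x \<epsilon>) * G (n + 1) (n + 1) (Complex x \<epsilon>)"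
      if "0 < \<epsilon>" for \<epsilon>
    proof -
      have "Complex x \<epsilon> \<in> resolvent_set J"
        using upper that by auto
      from green_wronskian[OF this, of n] show ?thesis
        using \<alpha> unfolding h_def by (simp add: field_simps power2_eq_square)
    qed
    have "((\<lambda>\<epsilon>. (of_real (1 / (2 * ?\<alpha>)))\<^sup>2 + G n n (Complex x \<epsilon>) * G (n + 1) (n + 1) (Complex x \<epsilon>)) \<longlongrightarrow> D) (at_right 0)"
      unfolding D_def by (intro tendsto_intros r r')
    moreover have "\<forall>\<^sub>F \<epsilon> in at_right 0. (h \<epsilon>)\<^sup>2
        = (of_real (1 / (2 * ?\<alpha>)))\<^sup>2 + G n n (Complex x \<epsilon>) * G (n + 1) (n + 1) (Complex x \<epsilon>)"
      unfolding eventually_at_right_field using sq by (intro exI[of _ 1]) auto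
    ultimately show ?thesis
      by (simp add: tendsto_cong)
  qed
  ultimately obtain l where l: "(h \<longlongrightarrow> l) (at_right 0)" "l\<^sup>2 = D"
    by (rule tendsto_of_tendsto_power2)
  have "Im D = 0"
    using r(2) r'(2) by (simp add: D_def power2_eq_square)
  then have "Re l = 0 \<or> Im l = 0"
    using l(2) by (auto simp: power2_eq_square)
  moreover have "((\<lambda>\<epsilon>. h \<epsilon> + of_real (1 / (2 * ?\<alpha>))) \<longlongrightarrow> l + of_real (1 / (2 * ?\<alpha>))) (at_right 0)"
    by (intro tendsto_intros l)
  ultimately show thesis
    using that[of "l + of_real (1 / (2 * ?\<alpha>))"] \<alpha> by (auto simp: h_def)
qed

text \<open>If the real part of \<open>a (n + 1) * g\<close> were not \<open>1 / 2\<close>, then the real part of row \<open>n\<close> of \<open>(J - x) G = 1\<close>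
  would exclude \<open>1 / 2\<close> on the other side of the diagonal as well. Both off-diagonal limits would be real,
  and the imaginary part of the row would force the diagonal limit to vanish.\<close>

lemma green_offdiag_limit_reflectionless:
  assumes upper: "{z. 0 < Im z} \<subseteq> resolvent_set J"
    and refl: "\<And>k. \<exists>r. ((\<lambda>\<epsilon>. G k k (Complex x \<epsilon>)) \<longlongrightarrow> r) (at_right 0) \<and> Re r = 0"
    and nz: "\<not> ((\<lambda>\<epsilon>. G n n (Complex x \<epsilon>)) \<longlongrightarrow> 0) (at_right 0)" and x: "x \<noteq> b n"
  obtains g where "((\<lambda>\<epsilon>. G n (n + 1) (Complex x \<epsilon>)) \<longlongrightarrow> g) (at_right 0)" "a (n + 1) * Re g = 1 / 2"
proof -
  obtain r0 where r0: "((\<lambda>\<epsilon>. G (n - 1) (n - 1) (Complex x \<epsilon>)) \<longlongrightarrow> r0) (at_right 0)" "Re r0 = 0"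
    using refl by metis
  obtain r where r: "((\<lambda>\<epsilon>. G n n (Complex x \<epsilon>)) \<longlongrightarrow> r) (at_right 0)" "Re r = 0"
    using refl by metis
  obtain r' where r': "((\<lambda>\<epsilon>. G (n + 1) (n + 1) (Complex x \<epsilon>)) \<longlongrightarrow> r') (at_right 0)" "Re r' = 0"
    using refl by metis
  obtain g where g: "((\<lambda>\<epsilon>. G n (n + 1) (Complex x \<epsilon>)) \<longlongrightarrow> g) (at_right 0)" "a (n + 1) * Re g = 1 / 2 \<or> Im g = 0"
    using green_offdiag_limit[OF upper r r'] by blast
  \<comment> \<open>The same dichotomy one site to the left, for the other off-diagonal entry that
    enters row \<open>n\<close>.\<close>
  obtain f where f: "((\<lambda>\<epsilon>. G (n - 1) n (Complex x \<epsilon>)) \<longlongrightarrow> f) (at_right 0)" "a n * Re f = 1 / 2 \<or> Im f = 0"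
    using green_offdiag_limit[OF upper r0, of r] r by auto
  have "((\<lambda>\<epsilon>. Complex x \<epsilon>) \<longlongrightarrow> of_real x + \<i> * of_real 0) (at_right 0)"
    unfolding Complex_eq by (intro tendsto_intros)
  then have Cx: "((\<lambda>\<epsilon>. Complex x \<epsilon>) \<longlongrightarrow> of_real x) (at_right 0)"
    by simp
  have "((\<lambda>\<epsilon>. of_real (a n) * G (n - 1) n (Complex x \<epsilon>) + (of_real (b n) - Complex x \<epsilon>) * G n n (Complex x \<epsilon>)
      + of_real (a (n + 1)) * G n (n + 1) (Complex x \<epsilon>)) \<longlongrightarrow>
      of_real (a n) * f + (of_real (b n) - of_real x) * r + of_real (a (n + 1)) * g) (at_right 0)"
    by (intro tendsto_intros Cx f(1) g(1) r(1))
  moreover have "\<forall>\<^sub>F \<epsilon> in at_right 0. of_real (a n) * G (n - 1) n (Complex x \<epsilon>)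
      + (of_real (b n) - Complex x \<epsilon>) * G n n (Complex x \<epsilon>) + of_real (a (n + 1)) * G n (n + 1) (Complex x \<epsilon>) = 1"
    unfolding eventually_at_right_field
  proof (intro exI[of _ 1] conjI allI impI)
    fix \<epsilon> :: real
    assume "0 < \<epsilon>"
    then have z: "Complex x \<epsilon> \<in> resolvent_set J"
      using upper by auto
    show "of_real (a n) * G (n - 1) n (Complex x \<epsilon>)
      + (of_real (b n) - Complex x \<epsilon>) * G n n (Complex x \<epsilon>) + of_real (a (n + 1)) * G n (n + 1) (Complex x \<epsilon>) = 1"
      using resolvent_row[OF z delta_in_l2, of n n] green_offdiag_sym[OF z, of n] by (simp add: delta_def)
  qed simp
  ultimately have "((\<lambda>\<epsilon>. 1) \<longlongrightarrow> of_real (a n) * f + (of_real (b n) - of_real x) * r + of_real (a (n + 1)) * g) (at_right (0::real))"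
    by (rule Lim_transform_eventually)
  then have row: "of_real (a n) * f + (of_real (b n) - of_real x) * r + of_real (a (n + 1)) * g = 1"
    by (simp add: tendsto_const_iff)
  have Re_row: "a n * Re f + a (n + 1) * Re g = 1"
    using arg_cong[OF row, of Re] r(2) by simp
  have Im_row: "a n * Im f + (b n - x) * Im r + a (n + 1) * Im g = 0"
    using arg_cong[OF row, of Im] r(2) by simp
  have "a (n + 1) * Re g = 1 / 2"
  proof (rule ccontr)
    assume "a (n + 1) * Re g \<noteq> 1 / 2"
    then have "Im g = 0" "Im f = 0"
      using g(2) f(2) Re_row by auto
    then have "r = 0"
      using Im_row x r(2) by (simp add: complex_eq_iff)
    then show False
      using r(1) nz by simp
  qed
  then show thesis
    using g(1) that by blast
qed

end

subsection \<open>Commuting the factors\<close>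

text \<open>The bounds \<open>c\<close> and \<open>M\<close> make both products of the factors,
  shifted by \<open>\<mu>\<close>, Jacobi operators; \<open>\<beta> n \<le> \<alpha> n\<close> makes
  \<open>A\<close> injective on \<open>l2\<close>.\<close>

locale bidiagonal_factors =
  fixes \<alpha> \<beta> :: "int \<Rightarrow> real" and \<mu> c M :: real
  assumes c_pos: "0 < c" and \<alpha>_ge: "\<And>n. c \<le> \<alpha> n" and \<beta>_ge: "\<And>n. c \<le> \<beta> n"
    and \<alpha>_le: "\<And>n. \<alpha> n \<le> M" and \<beta>_le: "\<And>n. \<beta> n \<le> M" and \<beta>_le_\<alpha>: "\<And>n. \<beta> n \<le> \<alpha> n"
begin

text \<open>\<open>a\<close>, \<open>b\<close> are the entries of \<open>A At + \<mu>\<close>, and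
  \<open>a'\<close>, \<open>b'\<close> those of \<open>At A + \<mu>\<close>.\<close>

definition a :: "int \<Rightarrow> real" where "a n = \<alpha> (n - 1) * \<beta> n"
definition b :: "int \<Rightarrow> real" where "b n = \<mu> + (\<alpha> n)\<^sup>2 + (\<beta> n)\<^sup>2"
definition a' :: "int \<Rightarrow> real" where "a' n = \<alpha> n * \<beta> n"
definition b' :: "int \<Rightarrow> real" where "b' n = \<mu> + (\<alpha> n)\<^sup>2 + (\<beta> (n + 1))\<^sup>2"

definition A :: seq_op where "A u n = of_real (\<alpha> n) * u n + of_real (\<beta> n) * u (n - 1)"
definition At :: seq_op where "At u n = of_real (\<alpha> n) * u n + of_real (\<beta> (n + 1)) * u (n + 1)"

lemma factors_pos: "0 < \<alpha> n" "0 < \<beta> n"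
  using c_pos \<alpha>_ge[of n] \<beta>_ge[of n] by linarith+

lemma M_pos: "0 < M"
  using factors_pos(1)[of 0] \<alpha>_le[of 0] by linarith

lemma is_jacobi_factors: "is_jacobi (a, b)" "is_jacobi (a', b')"
proof -
  have ge: "c * c \<le> \<alpha> n * \<beta> m" for n m
    using \<alpha>_ge[of n] \<beta>_ge[of m] c_pos by (intro mult_mono) auto
  have le: "\<bar>\<alpha> n * \<beta> m\<bar> \<le> M * M" for n m
    using \<alpha>_le[of n] \<beta>_le[of m] factors_pos[of n] factors_pos[of m] M_pos
    by (auto simp: abs_mult intro!: mult_mono)
  have sq: "\<bar>\<mu> + (\<alpha> n)\<^sup>2 + (\<beta> m)\<^sup>2\<bar> \<le> \<bar>\<mu>\<bar> + M\<^sup>2 + M\<^sup>2" for n m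
  proof -
    have "(\<alpha> n)\<^sup>2 \<le> M\<^sup>2" "(\<beta> m)\<^sup>2 \<le> M\<^sup>2"
      using \<alpha>_le[of n] \<beta>_le[of m] factors_pos[of n] factors_pos[of m] by (auto intro!: power_mono)
    then show ?thesis
      using zero_le_power2[of "\<alpha> n"] zero_le_power2[of "\<beta> m"] by linarith
  qed
  have "0 < c * c"
    using c_pos by simp
  then show "is_jacobi (a, b)" "is_jacobi (a', b')"
    using ge unfolding is_jacobi_def a_def b_def a'_def b'_def
    by (auto intro!: boundedI le sq simp: real_norm_def simp del: mult_pos_pos)
qed

sublocale J: jacobi a b
  by unfold_locales (rule is_jacobi_factors)

sublocale J': jacobi a' b'
  by unfold_locales (rule is_jacobi_factors)

lemma A_zero [simp]: "A (\<lambda>n. 0) = (\<lambda>n. 0)" and At_zero [simp]: "At (\<lambda>n. 0) = (\<lambda>n. 0)"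
  by (auto simp: A_def At_def)

lemma minus_scalar_J: "minus_scalar J.J z u = (\<lambda>n. A (At u) n - (z - of_real \<mu>) * u n)"
  by (rule ext) (simp add: minus_scalar_def jacobi_op_def A_def At_def a_def b_def algebra_simps power2_eq_square)

lemma minus_scalar_J': "minus_scalar J'.J z u = (\<lambda>n. At (A u) n - (z - of_real \<mu>) * u n)"
  by (rule ext) (simp add: minus_scalar_def jacobi_op_def A_def At_def a'_def b'_def algebra_simps power2_eq_square)

lemma
  assumes "u \<in> l2"
  shows A_in_l2: "A u \<in> l2" and l2_norm_A: "l2_norm (A u) \<le> 2 * M * l2_norm u"
    and At_in_l2: "At u \<in> l2" and l2_norm_At: "l2_norm (At u) \<le> 2 * M * l2_norm u"
proof -
  have bnd: "cmod (of_real (\<alpha> n)) \<le> M" "cmod (of_real (\<beta> n)) \<le> M" for n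
    using \<alpha>_le[of n] \<beta>_le[of n] factors_pos[of n] by simp_all
  have u: "(\<lambda>n. u (n - 1)) \<in> l2" "(\<lambda>n. u (n + 1)) \<in> l2"
    using assms by (simp_all only: l2_translate l2_translate')
  note au = l2_mult[of u "\<lambda>n. of_real (\<alpha> n)", OF assms bnd(1)]
    l2_norm_mult_le[of u "\<lambda>n. of_real (\<alpha> n)", OF assms bnd(1)]
  note bu = l2_mult[of _ "\<lambda>n. of_real (\<beta> n)", OF u(1) bnd(2)]
    l2_norm_mult_le[of _ "\<lambda>n. of_real (\<beta> n)", OF u(1) bnd(2)]
  note bu' = l2_mult[of _ "\<lambda>n. of_real (\<beta> (n + 1))", OF u(2) bnd(2)]
    l2_norm_mult_le[of _ "\<lambda>n. of_real (\<beta> (n + 1))", OF u(2) bnd(2)]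
  show "A u \<in> l2" "At u \<in> l2"
    unfolding A_def[abs_def] At_def[abs_def] by (rule l2_add[OF au(1) bu(1)], rule l2_add[OF au(1) bu'(1)])
  show "l2_norm (A u) \<le> 2 * M * l2_norm u"
    using l2_norm_triangle[OF au(1) bu(1)] au(2) bu(2)
    unfolding A_def[abs_def] l2_norm_translate' by linarith
  show "l2_norm (At u) \<le> 2 * M * l2_norm u"
    using l2_norm_triangle[OF au(1) bu'(1)] au(2) bu'(2)
    unfolding At_def[abs_def] l2_norm_translate by linarith
qed

text \<open>\<open>A u = 0\<close> is a first-order recursion whose factor has modulus
  \<open>\<beta> k / \<alpha> k\<close>, at most 1, so the modulus of \<open>u\<close> does not
  increase to the right; as it tends to 0 at the left end, it vanishes.\<close>

lemma A_injective:
  assumes "u \<in> l2" "A u = (\<lambda>n. 0)"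
  shows "u = (\<lambda>n. 0)"
proof
  fix m
  have "cmod (u k) \<le> cmod (u (k - 1))" for k
  proof -
    have "of_real (\<alpha> k) * u k = - (of_real (\<beta> k) * u (k - 1))"
      using fun_cong[OF assms(2), of k] by (simp add: A_def add_eq_0_iff)
    from arg_cong[OF this, of cmod] have "\<alpha> k * cmod (u k) = \<beta> k * cmod (u (k - 1))"
      using factors_pos[of k] by (simp add: norm_mult)
    also have "\<dots> \<le> \<alpha> k * cmod (u (k - 1))"
      using \<beta>_le_\<alpha>[of k] by (rule mult_right_mono) simp
    finally show ?thesis
      using factors_pos(1)[of k] by simp
  qed
  moreover have "(\<lambda>j. - cmod (u (m - int j))) \<longlonglongrightarrow> - cmod 0"
    by (intro tendsto_intros l2_tendsto_zero assms)
  ultimately have "0 \<le> - cmod (u m)"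
    using ge_zero_if_mono_tendsto_zero[of m "\<lambda>k. - cmod (u k)"] by simp
  then show "u m = 0"
    by simp
qed

section \<open>Spectrum of the commuted operator\<close>

lemma resolvent_kernel:
  assumes "z \<in> resolvent_set J.J" "u \<in> l2" "minus_scalar J.J z u = (\<lambda>n. 0)"
  shows "u = (\<lambda>n. 0)"
proof -
  have "(\<lambda>n. 0) \<in> l2"
    by (simp add: l2_def)
  moreover have "minus_scalar J.J z (\<lambda>n. 0) = (\<lambda>n. 0)"
    by (simp add: minus_scalar_J)
  ultimately show ?thesis
    using resolvent_eqI[OF assms] resolvent_eqI[OF assms(1), of "\<lambda>n. 0"] by simp
qed

definition R' :: "complex \<Rightarrow> seq_op" where
  "R' z f n = (At (resolvent J.J z (A f)) n - f n) / (z - of_real \<mu>)"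

text \<open>Applying \<open>A\<close> to \<open>R' z f\<close> produces \<open>A At\<close>, which
  the resolvent equation evaluates, and the outcome is
  \<open>A (R' z f) = resolvent J.J z (A f)\<close>. Inserting this into \<open>At A\<close> leaves
  \<open>f\<close>.\<close>

lemma
  assumes z: "z \<in> resolvent_set J.J" "z \<noteq> of_real \<mu>" and f: "f \<in> l2"
  shows R'_in_l2: "R' z f \<in> l2" and minus_scalar_R': "minus_scalar J'.J z (R' z f) = f"
proof -
  let ?w = "z - of_real \<mu>" and ?v = "resolvent J.J z (A f)"
  have v: "?v \<in> l2"
    by (rule resolvent_in_l2[OF z(1) A_in_l2[OF f]])
  have "(\<lambda>n. 1 / ?w * (At ?v n - f n)) \<in> l2"
    by (rule l2_scale[OF l2_diff[OF At_in_l2[OF v] f]])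
  then show "R' z f \<in> l2"
    unfolding R'_def[abs_def] by simp
  have "A (At ?v) n = A f n + ?w * ?v n" for n
    using fun_cong[OF minus_scalar_resolvent[OF z(1) A_in_l2[OF f]], of n]
    by (simp add: minus_scalar_J diff_eq_eq)
  moreover have "A (R' z f) n = (A (At ?v) n - A f n) / ?w" for n
    unfolding A_def R'_def by (simp add: add_divide_distrib diff_divide_distrib algebra_simps)
  ultimately have "A (R' z f) n = ?v n" for n
    using z(2) by simp
  then have "A (R' z f) = ?v"
    by blast
  then show "minus_scalar J'.J z (R' z f) = f"
    using z(2) by (simp add: minus_scalar_J') (simp add: R'_def)
qed

lemma resolvent_set_subset:
  assumes \<mu>: "of_real \<mu> \<in> resolvent_set J.J"
  shows "resolvent_set J.J \<subseteq> resolvent_set J'.J"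
proof
  fix z
  assume z: "z \<in> resolvent_set J.J"
  let ?R = "resolvent J.J z"
  obtain K where K: "K \<ge> 0" "\<And>g. g \<in> l2 \<Longrightarrow> l2_norm (?R g) \<le> K * l2_norm g"
    using resolvent_bound[OF z] by metis
  have in2: "?R g \<in> l2" if "g \<in> l2" for g
    by (rule resolvent_in_l2[OF z that])
  have RA: "l2_norm (?R (A f)) \<le> K * (2 * M * l2_norm f)" if "f \<in> l2" for f
    using K(2)[OF A_in_l2[OF that]] mult_left_mono[OF l2_norm_A[OF that] K(1)] by linarith
  show "z \<in> resolvent_set J'.J"
  proof (cases "z = of_real \<mu>")
    case False
    let ?w = "z - of_real \<mu>"
    show ?thesis
    proof (rule resolvent_setI[where R = "R' z"])
      fix u n
      assume u: "u \<in> l2" and "\<And>n. minus_scalar J'.J z u n = 0"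
      then have AtA: "At (A u) = (\<lambda>n. ?w * u n)"
        by (simp add: minus_scalar_J' fun_eq_iff)
      \<comment> \<open>\<open>A\<close> intertwines the two operators, so it sends the kernel of
        \<open>J' - z\<close> into that of \<open>J - z\<close>, which is trivial.\<close>
      have "minus_scalar J.J z (A u) = (\<lambda>n. 0)"
        unfolding minus_scalar_J AtA by (simp add: A_def algebra_simps)
      then have "A u = (\<lambda>n. 0)"
        by (rule resolvent_kernel[OF z A_in_l2[OF u]])
      then show "u n = 0"
        using fun_cong[OF AtA, of n] False by simp
    next
      fix f :: "int \<Rightarrow> complex"
      assume f: "f \<in> l2"
      let ?v = "?R (A f)"
      have v: "?v \<in> l2"
        by (rule in2[OF A_in_l2[OF f]])
      have diff: "(\<lambda>n. At ?v n - f n) \<in> l2"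
        by (rule l2_diff[OF At_in_l2[OF v] f])
      have "R' z f = (\<lambda>n. 1 / ?w * (At ?v n - f n))"
        by (simp add: R'_def fun_eq_iff)
      then have norm: "l2_norm (R' z f) \<le> cmod (1 / ?w) * l2_norm (\<lambda>n. At ?v n - f n)"
        using l2_norm_scale[OF diff, of "1 / ?w"] by simp
      have bound: "l2_norm (\<lambda>n. At ?v n - f n) \<le> 2 * M * (K * (2 * M * l2_norm f)) + l2_norm f"
      proof -
        have "2 * M * l2_norm ?v \<le> 2 * M * (K * (2 * M * l2_norm f))"
          by (rule mult_left_mono[OF RA[OF f]]) (use M_pos in simp)
        then show ?thesis
          using l2_norm_triangle_diff[OF At_in_l2[OF v] f] l2_norm_At[OF v] by linarith
      qed
      show "l2_norm (R' z f) \<le> (cmod (1 / ?w) * (2 * M * (K * (2 * M)) + 1)) * l2_norm f"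
        using order_trans[OF norm mult_left_mono[OF bound norm_ge_zero]] by (simp add: algebra_simps)
    qed (use R'_in_l2[OF z False] minus_scalar_R'[OF z False] J'.minus_scalar_in_l2 jacobi_op_linear in auto)
  next
    case True
    \<comment> \<open>At \<open>z = \<mu>\<close> the formula for \<open>R'\<close> would divide by
      zero. Here \<open>J - \<mu> = A At\<close> is invertible, so \<open>At ?R\<close> inverts
      \<open>A\<close> and \<open>?R A\<close> inverts \<open>At\<close>; their product in this
      order inverts \<open>At A\<close>.\<close>
    let ?S = "\<lambda>f. At (?R (?R (A f)))"
    show ?thesis
    proof (rule resolvent_setI[where R = ?S])
      fix u n
      assume u: "u \<in> l2" and "\<And>n. minus_scalar J'.J z u n = 0"
      then have "At (A u) = (\<lambda>n. 0)"
        by (simp add: minus_scalar_J' True fun_eq_iff)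
      then have "minus_scalar J.J z (A u) = (\<lambda>n. 0)"
        by (simp add: minus_scalar_J True)
      then have "A u = (\<lambda>n. 0)"
        by (rule resolvent_kernel[OF z A_in_l2[OF u]])
      then show "u n = 0"
        using A_injective[OF u] by simp
    next
      fix f :: "int \<Rightarrow> complex"
      assume f: "f \<in> l2"
      note v = in2[OF A_in_l2[OF f]]
      note v2 = in2[OF v]
      show "?S f \<in> l2"
        by (rule At_in_l2[OF v2])
      have AAt: "A (At (?R g)) = g" if "g \<in> l2" for g
        using minus_scalar_resolvent[OF z that] by (simp add: minus_scalar_J True)
      \<comment> \<open>\<open>At ?R A\<close> is the identity because \<open>A At ?R A = A\<close>
        and \<open>A\<close> is injective.\<close>
      have "(\<lambda>n. At (?R (A f)) n - f n) = (\<lambda>n. 0)"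
      proof (rule A_injective)
        show "(\<lambda>n. At (?R (A f)) n - f n) \<in> l2"
          by (rule l2_diff[OF At_in_l2[OF v] f])
        have "A (\<lambda>n. At (?R (A f)) n - f n) k = A (At (?R (A f))) k - A f k" for k
          unfolding A_def[of "\<lambda>n. At (?R (A f)) n - f n"] A_def[of "At (?R (A f))"] A_def[of f]
          by (simp add: algebra_simps)
        then show "A (\<lambda>n. At (?R (A f)) n - f n) = (\<lambda>n. 0)"
          by (simp add: AAt[OF A_in_l2[OF f]] fun_eq_iff)
      qed
      then have "At (?R (A f)) = f"
        by (simp add: fun_eq_iff)
      then show "minus_scalar J'.J z (?S f) = f"
        unfolding minus_scalar_J' AAt[OF v] by (simp add: True)
      have "l2_norm (?S f) \<le> 2 * M * l2_norm (?R (?R (A f)))"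
        by (rule l2_norm_At[OF v2])
      also have "\<dots> \<le> 2 * M * (K * (K * (2 * M * l2_norm f)))"
        using K(2)[OF v] mult_left_mono[OF RA[OF f] K(1)] M_pos by (intro mult_left_mono) auto
      finally show "l2_norm (?S f) \<le> (2 * M * (K * (K * (2 * M)))) * l2_norm f"
        by (simp add: mult.assoc)
    qed (use J'.minus_scalar_in_l2 jacobi_op_linear in auto)
  qed
qed

section \<open>Green function of the commuted operator and its boundary values\<close>

text \<open>\<open>A\<close> sends \<open>delta n\<close> to a combination of \<open>delta n\<close>
  and \<open>delta (n + 1)\<close>, so the entry comes from the quadratic form of the resolvent of
  \<open>J\<close> at this vector. The mixed coefficient \<open>\<alpha> n * \<beta> (n + 1)\<close>
  is \<open>a (n + 1)\<close>, counted twice by symmetry.\<close>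

lemma green_commuted:
  assumes z: "z \<in> resolvent_set J.J" "z \<in> resolvent_set J'.J" "z \<noteq> of_real \<mu>"
  shows "green n z J'.J = (of_real ((\<alpha> n)\<^sup>2) * J.G n n z + 2 * of_real (a (n + 1)) * J.G n (n + 1) z
    + of_real ((\<beta> (n + 1))\<^sup>2) * J.G (n + 1) (n + 1) z - 1) / (z - of_real \<mu>)"
proof -
  define v where "v k = of_real (\<alpha> n) * J.G k n z + of_real (\<beta> (n + 1)) * J.G k (n + 1) z" for k
  have A_delta: "A (delta n) = (\<lambda>k. of_real (\<alpha> n) * delta n k + of_real (\<beta> (n + 1)) * delta (n + 1) k)"
    by (auto simp: A_def delta_def fun_eq_iff)
  have "v \<in> l2"
    unfolding v_def by (intro l2_add l2_scale resolvent_in_l2 z delta_in_l2)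
  moreover have "minus_scalar J.J z v = A (delta n)"
  proof
    fix k
    show "minus_scalar J.J z v k = A (delta n) k"
      unfolding A_delta J.resolvent_row[OF z(1) delta_in_l2, of k, symmetric]
      by (simp add: minus_scalar_def jacobi_op_def v_def algebra_simps)
  qed
  ultimately have "resolvent J.J z (A (delta n)) = v"
    by (rule resolvent_eqI[OF z(1)])
  moreover have "resolvent J'.J z (delta n) = R' z (delta n)"
    using z by (intro resolvent_eqI R'_in_l2 minus_scalar_R' delta_in_l2) auto
  ultimately show ?thesis
    unfolding J'.green_eq
    using J.green_offdiag_sym[OF z(1), of n]
    by (simp add: R'_def At_def v_def a_def power2_eq_square algebra_simps)
qed

text \<open>In the limit of \<open>green_commuted\<close> the diagonal terms are imaginary,
  \<open>2 * a (n + 1) * g\<close> has real part 1 and cancels the \<open>- 1\<close>, and the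
  denominator becomes the real number \<open>x - \<mu>\<close>, nonzero because \<open>\<mu>\<close>
  is outside \<open>E\<close>.\<close>

lemma reflectionless_commuted:
  assumes spec: "l2_spectrum J.J \<subseteq> of_real ` E" and \<mu>: "\<mu> \<notin> E" and refl: "reflectionless_on J.J E"
  shows "reflectionless_on J'.J E"
  unfolding reflectionless_on_def
proof
  fix n
  have res: "z \<in> resolvent_set J.J" if "z \<notin> of_real ` E" for z
    using spec that by (auto simp: l2_spectrum_def)
  then have upper: "{z. 0 < Im z} \<subseteq> resolvent_set J.J"
    by (auto intro!: res)
  have res': "resolvent_set J.J \<subseteq> resolvent_set J'.J"
    by (intro resolvent_set_subset res) (use \<mu> in auto)
  \<comment> \<open>The off-diagonal limit at \<open>n\<close> draws on diagonal limits at
    neighbouring sites; \<open>int\<close> is countable, so the exceptional null sets are discarded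
    together.\<close>
  have "AE x in lebesgue. \<forall>k. x \<in> E \<longrightarrow>
      (\<exists>r. ((\<lambda>\<epsilon>. J.G k k (Complex x \<epsilon>)) \<longlongrightarrow> r) (at_right 0) \<and> Re r = 0)"
    unfolding AE_all_countable using refl by (simp add: reflectionless_on_def J.green_eq)
  moreover have "AE x in lebesgue. \<not> ((\<lambda>\<epsilon>. J.G n n (Complex x \<epsilon>)) \<longlongrightarrow> 0) (at_right 0)"
    by (rule J.AE_green_not_tendsto_zero[OF upper])
  moreover have "AE x in lebesgue. x \<noteq> b n"
    by (rule AE_completion[OF AE_lborel_singleton])
  ultimately show "AE x in lebesgue. x \<in> E \<longrightarrow>
      (\<exists>r. ((\<lambda>\<epsilon>. green n (Complex x \<epsilon>) J'.J) \<longlongrightarrow> r) (at_right 0) \<and> Re r = 0)"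
  proof eventually_elim
    case (elim x)
    show ?case
    proof
      assume x: "x \<in> E"
      then have refl_x: "\<exists>r. ((\<lambda>\<epsilon>. J.G k k (Complex x \<epsilon>)) \<longlongrightarrow> r) (at_right 0) \<and> Re r = 0" for k
        using elim(1) by blast
      obtain g where g: "((\<lambda>\<epsilon>. J.G n (n + 1) (Complex x \<epsilon>)) \<longlongrightarrow> g) (at_right 0)" "a (n + 1) * Re g = 1 / 2"
        using J.green_offdiag_limit_reflectionless[OF upper refl_x elim(2,3)] by blast
      obtain r where r: "((\<lambda>\<epsilon>. J.G n n (Complex x \<epsilon>)) \<longlongrightarrow> r) (at_right 0)" "Re r = 0"
        using refl_x by metis
      obtain r' where r': "((\<lambda>\<epsilon>. J.G (n + 1) (n + 1) (Complex x \<epsilon>)) \<longlongrightarrow> r') (at_right 0)" "Re r' = 0"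
        using refl_x by metis
      define L where "L = (of_real ((\<alpha> n)\<^sup>2) * r + 2 * of_real (a (n + 1)) * g + of_real ((\<beta> (n + 1))\<^sup>2) * r' - 1)
        / (of_real x - of_real \<mu>)"
      have "((\<lambda>\<epsilon>. Complex x \<epsilon>) \<longlongrightarrow> of_real x + \<i> * of_real 0) (at_right 0)"
        unfolding Complex_eq by (intro tendsto_intros)
      then have Cx: "((\<lambda>\<epsilon>. Complex x \<epsilon>) \<longlongrightarrow> of_real x) (at_right 0)"
        by simp
      have nz: "complex_of_real x - of_real \<mu> \<noteq> 0"
        using x \<mu> by auto
      have "((\<lambda>\<epsilon>. (of_real ((\<alpha> n)\<^sup>2) * J.G n n (Complex x \<epsilon>) + 2 * of_real (a (n + 1)) * J.G n (n + 1) (Complex x \<epsilon>)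
          + of_real ((\<beta> (n + 1))\<^sup>2) * J.G (n + 1) (n + 1) (Complex x \<epsilon>) - 1) / (Complex x \<epsilon> - of_real \<mu>)) \<longlongrightarrow> L)
          (at_right 0)"
        unfolding L_def by (intro tendsto_intros Cx g(1) r(1) r'(1) nz)
      moreover have "\<forall>\<^sub>F \<epsilon> in at_right 0. green n (Complex x \<epsilon>) J'.J
          = (of_real ((\<alpha> n)\<^sup>2) * J.G n n (Complex x \<epsilon>) + 2 * of_real (a (n + 1)) * J.G n (n + 1) (Complex x \<epsilon>)
          + of_real ((\<beta> (n + 1))\<^sup>2) * J.G (n + 1) (n + 1) (Complex x \<epsilon>) - 1) / (Complex x \<epsilon> - of_real \<mu>)"
        unfolding eventually_at_right_field
      proof (intro exI[of _ 1] conjI allI impI green_commuted)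
        fix \<epsilon> :: real
        assume "0 < \<epsilon>"
        then show "Complex x \<epsilon> \<in> resolvent_set J.J"
          using upper by auto
        then show "Complex x \<epsilon> \<in> resolvent_set J'.J"
          using res' by blast
      qed (auto simp: complex_eq_iff)
      ultimately have "((\<lambda>\<epsilon>. green n (Complex x \<epsilon>) J'.J) \<longlongrightarrow> L) (at_right 0)"
        by (simp add: tendsto_cong)
      moreover have "Re L = 0"
        using g(2) r(2) r'(2) unfolding L_def of_real_diff[symmetric] Re_divide_of_real by simp
      ultimately show "\<exists>r. ((\<lambda>\<epsilon>. green n (Complex x \<epsilon>) J'.J) \<longlongrightarrow> r) (at_right 0) \<and> Re r = 0"
        by blast
    qed
  qed
qed

lemma commuted_in_reflectionless_class:
  assumes "(a, b) \<in> reflectionless_class E" "\<mu> \<notin> E"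
  shows "(a', b') \<in> reflectionless_class E"
proof -
  have spec: "l2_spectrum J.J \<subseteq> of_real ` E" and refl: "reflectionless_on J.J E"
    using assms(1) by (auto simp: reflectionless_class_def)
  have "of_real \<mu> \<in> resolvent_set J.J"
    using spec assms(2) by (auto simp: l2_spectrum_def)
  then have "l2_spectrum J'.J \<subseteq> l2_spectrum J.J"
    using resolvent_set_subset by (auto simp: l2_spectrum_def)
  then show ?thesis
    using spec is_jacobi_factors(2) reflectionless_commuted[OF spec assms(2) refl]
    by (auto simp: reflectionless_class_def)
qed

end

subsection \<open>Factoring a Schroedinger operator\<close>

text \<open>\<open>t\<close> will be the square of \<open>\<alpha>\<close>. It is a limit of
  truncated continued fractions: the map from \<open>f\<close> to \<open>D n - 1 / f (n - 1)\<close>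
  is monotone on positive sequences, preserves \<open>f \<ge> 2\<close> because
  \<open>D \<ge> 3\<close>, and lowers the starting point \<open>D\<close>, so its iterates
  decrease.\<close>

lemma riccati_solution:
  fixes D :: "int \<Rightarrow> real"
  assumes D: "\<And>n. 3 \<le> D n"
  obtains t where "\<And>n. 2 \<le> t n" "\<And>n. t n \<le> D n" "\<And>n. t n + 1 / t (n - 1) = D n"
proof -
  \<comment> \<open>\<open>s k n\<close> is \<open>D n - 1 / (D (n - 1) - 1 / ...)\<close> cut off
    after \<open>k\<close> fractions.\<close>
  define s where "s = rec_nat D (\<lambda>_ f n. D n - 1 / f (n - 1))"
  have s: "s 0 n = D n" "s (Suc k) n = D n - 1 / s k (n - 1)" for k n
    by (simp_all add: s_def)
  have ge: "2 \<le> s k n" for k n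
  proof (induction k arbitrary: n)
    case 0
    then show ?case
      using D[of n] by (simp add: s)
  next
    case (Suc k)
    have "1 / s k (n - 1) \<le> 1 / 2"
      using Suc[of "n - 1"] by (intro divide_left_mono) auto
    then show ?case
      using D[of n] by (simp add: s)
  qed
  have dec: "s (Suc k) n \<le> s k n" for k n
  proof (induction k arbitrary: n)
    case 0
    then show ?case
      using ge[of 0 "n - 1"] by (simp add: s)
  next
    case (Suc k)
    have "1 / s k (n - 1) \<le> 1 / s (Suc k) (n - 1)"
      using Suc[of "n - 1"] ge[of k "n - 1"] ge[of "Suc k" "n - 1"] by (intro divide_left_mono) auto
    then show ?case
      by (simp add: s(2)[of "Suc k"] s(2)[of k n])
  qed
  have "\<exists>l. (\<lambda>k. s k n) \<longlonglongrightarrow> l" for n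
    using decseq_convergent[of "\<lambda>k. s k n" 2] decseq_SucI[of "\<lambda>k. s k n"] dec ge by metis
  then obtain t where t: "\<And>n. (\<lambda>k. s k n) \<longlonglongrightarrow> t n"
    by metis
  have t_ge: "2 \<le> t n" for n
    by (rule LIMSEQ_le_const[OF t]) (use ge in blast)
  have "t n = D n - 1 / t (n - 1)" for n
  proof (rule LIMSEQ_unique)
    show "(\<lambda>k. s (Suc k) n) \<longlonglongrightarrow> t n"
      by (rule LIMSEQ_Suc[OF t])
    show "(\<lambda>k. s (Suc k) n) \<longlonglongrightarrow> D n - 1 / t (n - 1)"
      unfolding s by (intro tendsto_intros t) (use t_ge[of "n - 1"] in simp)
  qed
  moreover have "t n \<le> D n" for n
    using decseq_ge[OF decseq_SucI[of "\<lambda>k. s k n", OF dec] t, of 0] by (simp add: s)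
  ultimately show thesis
    using that[of t] t_ge by (simp add: eq_diff_eq)
qed

lemma nonconstant_offdiagonal_in_class:
  assumes "compact E" and V: "schroedinger V \<in> reflectionless_class E" and "\<nexists>C. \<forall>n. V n = C"
  obtains p n where "p \<in> reflectionless_class E" "fst p n \<noteq> 1"
proof -
  obtain B where B: "\<And>x. x \<in> E \<Longrightarrow> \<bar>x\<bar> \<le> B"
    using compact_imp_bounded[OF assms(1)] by (auto simp: bounded_iff)
  obtain N where N: "\<And>n. \<bar>V n\<bar> \<le> N"
    using V by (auto simp: reflectionless_class_def is_jacobi_def schroedinger_def bounded_iff)
  \<comment> \<open>Far enough left that \<open>V - \<mu>\<close> is at least 3, as
    \<open>riccati_solution\<close> requires, and that \<open>\<mu>\<close> lies outside
    \<open>E\<close>.\<close>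
  define \<mu> where "\<mu> = - \<bar>B\<bar> - N - 3"
  have \<mu>: "\<mu> \<notin> E"
    using B[of \<mu>] N[of 0] by (auto simp: \<mu>_def)
  define D where "D n = V n - \<mu>" for n
  have "3 \<le> D n" for n
    using N[of n] unfolding D_def \<mu>_def by linarith
  then obtain t where t: "\<And>n. 2 \<le> t n" "\<And>n. t n \<le> D n" "\<And>n. t n + 1 / t (n - 1) = D n"
    using riccati_solution by blast
  define T where "T = \<bar>B\<bar> + 2 * N + 3"
  have t_le: "t n \<le> T" for n
    using t(2)[of n] N[of n] by (simp add: D_def \<mu>_def T_def abs_le_iff)
  have T: "2 \<le> T"
    using t(1)[of 0] t_le[of 0] by linarith
  define \<alpha> where "\<alpha> n = sqrt (t n)" for n
  \<comment> \<open>This choice makes \<open>a n = 1\<close>; then \<open>b n = V n\<close> is the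
    Riccati equation for \<open>t\<close>.\<close>
  define \<beta> where "\<beta> n = 1 / \<alpha> (n - 1)" for n
  have one_le_\<alpha>: "1 \<le> \<alpha> n" and \<alpha>_le: "\<alpha> n \<le> sqrt T" and \<alpha>_sq: "(\<alpha> n)\<^sup>2 = t n" for n
    using t(1)[of n] t_le[of n] by (auto simp: \<alpha>_def)
  have \<beta>_le: "\<beta> n \<le> 1" for n
    using one_le_\<alpha>[of "n - 1"] by (simp add: \<beta>_def)
  have sqrtT: "1 \<le> sqrt T"
    using T by simp
  have \<beta>_ge: "1 / sqrt T \<le> \<beta> n" for n
    unfolding \<beta>_def using one_le_\<alpha>[of "n - 1"] \<alpha>_le[of "n - 1"] sqrtT by (intro divide_left_mono) auto
  interpret bidiagonal_factors \<alpha> \<beta> \<mu> "1 / sqrt T" "sqrt T"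
  proof unfold_locales
    show "0 < 1 / sqrt T"
      using T by simp
    have "1 / sqrt T \<le> 1"
      using sqrtT by simp
    then show "1 / sqrt T \<le> \<alpha> n" for n
      using one_le_\<alpha>[of n] by linarith
    show "\<beta> n \<le> sqrt T" for n
      using \<beta>_le[of n] sqrtT by linarith
    show "\<beta> n \<le> \<alpha> n" for n
      using \<beta>_le[of n] one_le_\<alpha>[of n] by linarith
  qed (fact \<beta>_ge \<alpha>_le)+
  have "a n = 1" for n
    using one_le_\<alpha>[of "n - 1"] by (simp add: a_def \<beta>_def)
  moreover have "b n = V n" for n
    using t(3)[of n] \<alpha>_sq[of n] \<alpha>_sq[of "n - 1"] by (simp add: b_def \<beta>_def D_def power_divide)
  ultimately have "(a, b) = schroedinger V"
    by (auto simp: schroedinger_def)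
  then have "(a', b') \<in> reflectionless_class E"
    using V \<mu> commuted_in_reflectionless_class by simp
  moreover have "\<exists>n. a' n \<noteq> 1"
  proof (rule ccontr)
    assume "\<not> ?thesis"
    then have step: "\<alpha> n = \<alpha> (n - 1)" for n
      using one_le_\<alpha>[of "n - 1"] by (simp add: a'_def \<beta>_def)
    have "\<alpha> n = \<alpha> 0" for n
    proof (induction n rule: int_induct[of _ 0])
      case (step1 i)
      then show ?case
        using step[of "i + 1"] by simp
    next
      case (step2 i)
      then show ?case
        using step[of i] by simp
    qed simp
    then have const: "t n = t 0" for n
      using \<alpha>_sq by metis
    have "V n = t 0 + 1 / t 0 + \<mu>" for n
      using t(3)[of n] const[of n] const[of "n - 1"] by (simp add: D_def)
    then show False
      using assms(3) by blast
  qed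
  ultimately show thesis
    using that[of "(a', b')"] by auto
qed

section \<open>Orbit closure of the Schroedinger operator and the conclusion\<close>

text \<open>Having all off-diagonal entries equal to 1 is a closed condition for pointwise
  convergence, and the shift and its inverse preserve it.\<close>

lemma fst_closure_orbit_schroedinger:
  assumes "p \<in> closure (two_sided_orbit shift_conj (schroedinger V))"
  shows "fst p n = 1"
proof -
  let ?C = "{p :: jacobi_params. \<forall>n. fst p n = 1}"
  have "continuous_on UNIV (\<lambda>p :: jacobi_params. fst p n)" for n
    by (rule continuous_on_product_then_coordinatewise[OF continuous_on_fst[OF continuous_on_id]])
  then have "closed ?C"
    by (intro closed_Collect_all closed_Collect_eq) auto
  moreover have "(shift_conj ^^ k) (schroedinger V) \<in> ?C" for k
    by (induction k) (auto simp: schroedinger_def shift_conj_def split: prod.splits)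
  moreover have "(inv shift_conj ^^ k) (schroedinger V) \<in> ?C" for k
    by (induction k) (auto simp: schroedinger_def inv_shift_conj split: prod.splits)
  ultimately have "closure (two_sided_orbit shift_conj (schroedinger V)) \<subseteq> ?C"
    by (intro closure_minimal) (auto simp: two_sided_orbit_def)
  then show ?thesis
    using assms by blast
qed

theorem theorem1p3:
  fixes E :: "real set" and V :: "int \<Rightarrow> real"
  assumes "compact E"
    and "emeasure lebesgue E > 0"
    and "schroedinger V \<in> reflectionless_class E"
  shows "(\<exists>C. \<forall>n. V n = C) \<or> \<not> minimal_system (reflectionless_class E) shift_conj"
proof (rule disjCI, rule notnotD, rule notI)
  assume minimal: "\<not> \<not> minimal_system (reflectionless_class E) shift_conj" and "\<nexists>C. \<forall>n. V n = C"
  then obtain p n where p: "p \<in> reflectionless_class E" "fst p n \<noteq> 1"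
    using nonconstant_offdiagonal_in_class[OF assms(1,3)] by metis
  have "p \<in> closure (two_sided_orbit shift_conj (schroedinger V))"
    using minimal assms(3) p(1) by (auto simp: minimal_system_def)
  then show False
    using fst_closure_orbit_schroedinger p(2) by blast
qed

end
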